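(* Let $\Sigma$ be a small category and let $\mathcal{A}$ be a $\Sigma$-co-complete abelian category. Then the following conditions are equivalent: (a) the functor $\mathrm{colim}_{\Sigma}:\mathrm{Fun}(\Sigma,\mathcal{A})\to\mathcal{A}$ is exact; (b) for every object $A$ of $\mathcal{A}$ and every short exact sequence $\eta:\ 0\to\kappa^{\Sigma}(A)\xrightarrow{\phi}F\xrightarrow{\psi}G\to 0$ in $\mathrm{Fun}(\Sigma,\mathcal{A})$, the morphism $f_{\eta}$ is a monomorphism.
   Context: A category is called small when the isomorphism classes of its objects form a set. $\mathrm{Fun}(\Sigma,\mathcal{A})$ is the abelian category of functors $\Sigma\to\mathcal{A}$ with natural transformations (kernels, cokernels and exactness computed objectwise). $\mathcal{A}$ is $\Sigma$-co-complete if every functor $\Sigma\to\mathcal{A}$ has a colimit in $\mathcal{A}$. For $F\in\mathrm{Fun}(\Sigma,\mathcal{A})$ write $C_F:=\mathrm{colim}_{\Sigma}(F)$, with universal natural transformation $\rho^F:F\to\kappa^{\Sigma}(C_F)$. Here $\kappa^{\Sigma}:\mathcal{A}\to\mathrm{Fun}(\Sigma,\mathcal{A})$ is the constant diagram functor: $\kappa^{\Sigma}(A)$ sends every object of $\Sigma$ to $A$ and every morphism to $1_A$; for a morphism $f$ of $\mathcal{A}$, $\kappa^{\Sigma}_f=\kappa^{\Sigma}(f)$ is the natural transformation all of whose components are $f$. Co-diagonal: for $A\in\mathcal{A}$, $\nabla^A:C_{\kappa^{\Sigma}(A)}\to A$ is the unique morphism with $\kappa^{\Sigma}_{\nabla^A}\circ\rho^{\kappa^{\Sigma}(A)}=1_{\kappa^{\Sigma}(A)}$.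 Definition of $f_\eta$: given a short exact sequence $\eta:\ 0\to\kappa^{\Sigma}(A)\xrightarrow{\phi}F\xrightarrow{\psi}G\to0$ in $\mathrm{Fun}(\Sigma,\mathcal{A})$, let $Z_\eta$ be the pushout of $\mathrm{colim}_\Sigma(\phi):C_{\kappa^{\Sigma}(A)}\to C_F$ and $\nabla^A:C_{\kappa^{\Sigma}(A)}\to A$, with structure morphisms $\mu_\eta:C_F\to Z_\eta$ and $f_\eta:A\to Z_\eta$, so that $\mu_\eta\circ\mathrm{colim}_\Sigma(\phi)=f_\eta\circ\nabla^A$. *)

theory Defs
  imports "HOL-Library.FuncSet" "HOL-Algebra.Group"
begin

section \<open>Categories and functors\<close>

text \<open>
  Objects and arrows are elements of carrier sets, so every category here has a set of objects and
  a set of arrows; in particular it is small, and no further smallness condition is needed.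
  The object and arrow types of different categories are independent type variables.
  \<open>Comp C g f\<close> is the composite \<open>g \<circ> f\<close> (first \<open>f\<close>, then \<open>g\<close>); it is
  only constrained when \<open>Cod C f = Dom C g\<close>.
\<close>

record ('o, 'm) cat =
  Obj :: "'o set"
  Arr :: "'m set"
  Dom :: "'m \<Rightarrow> 'o"
  Cod :: "'m \<Rightarrow> 'o"
  Id :: "'o \<Rightarrow> 'm"
  Comp :: "'m \<Rightarrow> 'm \<Rightarrow> 'm"

definition Hom :: "('o, 'm) cat \<Rightarrow> 'o \<Rightarrow> 'o \<Rightarrow> 'm set" where
  "Hom C X Y = {f \<in> Arr C. Dom C f = X \<and> Cod C f = Y}"

locale category =
  fixes C :: "('o, 'm) cat"
  assumes Dom_in: "f \<in> Arr C \<Longrightarrow> Dom C f \<in> Obj C"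
    and Cod_in: "f \<in> Arr C \<Longrightarrow> Cod C f \<in> Obj C"
    and Id_in: "X \<in> Obj C \<Longrightarrow> Id C X \<in> Hom C X X"
    and Comp_in: "f \<in> Hom C X Y \<Longrightarrow> g \<in> Hom C Y Z \<Longrightarrow> Comp C g f \<in> Hom C X Z"
    and Comp_Id: "f \<in> Hom C X Y \<Longrightarrow> Comp C f (Id C X) = f"
    and Id_Comp: "f \<in> Hom C X Y \<Longrightarrow> Comp C (Id C Y) f = f"
    and Comp_assoc: "f \<in> Hom C W X \<Longrightarrow> g \<in> Hom C X Y \<Longrightarrow> h \<in> Hom C Y Z \<Longrightarrow>
      Comp C h (Comp C g f) = Comp C (Comp C h g) f"

record ('o, 'm, 'p, 'q) fctr =
  on_obj :: "'o \<Rightarrow> 'p"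
  on_arr :: "'m \<Rightarrow> 'q"

definition is_functor :: "('o, 'm) cat \<Rightarrow> ('p, 'q) cat \<Rightarrow> ('o, 'm, 'p, 'q) fctr \<Rightarrow> bool" where
  "is_functor C D F \<longleftrightarrow>
     (\<forall>X \<in> Obj C. on_obj F X \<in> Obj D) \<and>
     (\<forall>f \<in> Arr C. on_arr F f \<in> Hom D (on_obj F (Dom C f)) (on_obj F (Cod C f))) \<and>
     (\<forall>X \<in> Obj C. on_arr F (Id C X) = Id D (on_obj F X)) \<and>
     (\<forall>f \<in> Arr C. \<forall>g \<in> Arr C. Cod C f = Dom C g \<longrightarrow>
        on_arr F (Comp C g f) = Comp D (on_arr F g) (on_arr F f))"

section \<open>Limits, colimits and exactness in a category\<close>

definition monic :: "('o, 'm) cat \<Rightarrow> 'm \<Rightarrow> bool" where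
  "monic C f \<longleftrightarrow> f \<in> Arr C \<and>
     (\<forall>W. \<forall>g \<in> Hom C W (Dom C f). \<forall>h \<in> Hom C W (Dom C f). Comp C f g = Comp C f h \<longrightarrow> g = h)"

definition epic :: "('o, 'm) cat \<Rightarrow> 'm \<Rightarrow> bool" where
  "epic C f \<longleftrightarrow> f \<in> Arr C \<and>
     (\<forall>W. \<forall>g \<in> Hom C (Cod C f) W. \<forall>h \<in> Hom C (Cod C f) W. Comp C g f = Comp C h f \<longrightarrow> g = h)"

definition zero_obj :: "('o, 'm) cat \<Rightarrow> 'o \<Rightarrow> bool" where
  "zero_obj C Z \<longleftrightarrow> Z \<in> Obj C \<and>
     (\<forall>X \<in> Obj C. (\<exists>!f. f \<in> Hom C X Z) \<and> (\<exists>!f. f \<in> Hom C Z X))"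

text \<open>
  Zero arrows, kernels and exactness are phrased without the additive structure, so that they apply
  verbatim to the functor category; in a preadditive category with a zero object, the zero arrows
  are exactly the neutral elements of the hom groups.
\<close>

definition zero_arr :: "('o, 'm) cat \<Rightarrow> 'm \<Rightarrow> bool" where
  "zero_arr C f \<longleftrightarrow> f \<in> Arr C \<and>
     (\<exists>Z u v. zero_obj C Z \<and> u \<in> Hom C (Dom C f) Z \<and> v \<in> Hom C Z (Cod C f) \<and> f = Comp C v u)"

definition is_kernel :: "('o, 'm) cat \<Rightarrow> 'm \<Rightarrow> 'm \<Rightarrow> bool" where
  "is_kernel C f k \<longleftrightarrow> f \<in> Arr C \<and> k \<in> Arr C \<and> Cod C k = Dom C f \<and> zero_arr C (Comp C f k) \<and>
     (\<forall>h \<in> Arr C. Cod C h = Dom C f \<and> zero_arr C (Comp C f h) \<longrightarrow>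
        (\<exists>!u. u \<in> Hom C (Dom C h) (Dom C k) \<and> Comp C k u = h))"

definition is_cokernel :: "('o, 'm) cat \<Rightarrow> 'm \<Rightarrow> 'm \<Rightarrow> bool" where
  "is_cokernel C f c \<longleftrightarrow> f \<in> Arr C \<and> c \<in> Arr C \<and> Dom C c = Cod C f \<and> zero_arr C (Comp C c f) \<and>
     (\<forall>h \<in> Arr C. Dom C h = Cod C f \<and> zero_arr C (Comp C h f) \<longrightarrow>
        (\<exists>!u. u \<in> Hom C (Cod C c) (Cod C h) \<and> Comp C u c = h))"

definition is_image :: "('o, 'm) cat \<Rightarrow> 'm \<Rightarrow> 'm \<Rightarrow> bool" where
  "is_image C f m \<longleftrightarrow> (\<exists>c. is_cokernel C f c \<and> is_kernel C c m)"

definition exact_at :: "('o, 'm) cat \<Rightarrow> 'm \<Rightarrow> 'm \<Rightarrow> bool" where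
  "exact_at C f g \<longleftrightarrow> (\<exists>m. is_image C f m \<and> is_kernel C g m)"

definition short_exact :: "('o, 'm) cat \<Rightarrow> 'm \<Rightarrow> 'm \<Rightarrow> bool" where
  "short_exact C f g \<longleftrightarrow> monic C f \<and> exact_at C f g \<and> epic C g"

definition exact_functor :: "('o, 'm) cat \<Rightarrow> ('p, 'q) cat \<Rightarrow> ('o, 'm, 'p, 'q) fctr \<Rightarrow> bool" where
  "exact_functor C D F \<longleftrightarrow> is_functor C D F \<and>
     (\<forall>f g. short_exact C f g \<longrightarrow> short_exact D (on_arr F f) (on_arr F g))"

text \<open>\<open>is_pushout C a b m f\<close>: the square \<open>m \<circ> a = f \<circ> b\<close> is a pushout of \<open>a\<close> and \<open>b\<close>.\<close>

definition is_pushout :: "('o, 'm) cat \<Rightarrow> 'm \<Rightarrow> 'm \<Rightarrow> 'm \<Rightarrow> 'm \<Rightarrow> bool" where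
  "is_pushout C a b m f \<longleftrightarrow>
     a \<in> Arr C \<and> b \<in> Arr C \<and> m \<in> Arr C \<and> f \<in> Arr C \<and>
     Dom C a = Dom C b \<and> Dom C m = Cod C a \<and> Dom C f = Cod C b \<and> Cod C m = Cod C f \<and>
     Comp C m a = Comp C f b \<and>
     (\<forall>W. \<forall>x \<in> Hom C (Cod C a) W. \<forall>y \<in> Hom C (Cod C b) W. Comp C x a = Comp C y b \<longrightarrow>
        (\<exists>!u. u \<in> Hom C (Cod C m) W \<and> Comp C u m = x \<and> Comp C u f = y))"

section \<open>Abelian categories\<close>

definition preadditive :: "('o, 'm) cat \<Rightarrow> ('o \<Rightarrow> 'o \<Rightarrow> 'm monoid) \<Rightarrow> bool" where
  "preadditive C H \<longleftrightarrow> category C \<and>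
     (\<forall>X \<in> Obj C. \<forall>Y \<in> Obj C. comm_group (H X Y) \<and> carrier (H X Y) = Hom C X Y) \<and>
     (\<forall>X \<in> Obj C. \<forall>Y \<in> Obj C. \<forall>Z \<in> Obj C.
        (\<forall>f \<in> Hom C X Y. \<forall>f' \<in> Hom C X Y. \<forall>g \<in> Hom C Y Z.
           Comp C g (f \<otimes>\<^bsub>H X Y\<^esub> f') = Comp C g f \<otimes>\<^bsub>H X Z\<^esub> Comp C g f') \<and>
        (\<forall>f \<in> Hom C X Y. \<forall>g \<in> Hom C Y Z. \<forall>g' \<in> Hom C Y Z.
           Comp C (g \<otimes>\<^bsub>H Y Z\<^esub> g') f = Comp C g f \<otimes>\<^bsub>H X Z\<^esub> Comp C g' f))"

text \<open>
  The hom groups \<open>H X Y\<close> are written multiplicatively as in the library. In a preadditive category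
  the missing biproduct equations \<open>q \<circ> i = 0\<close> and \<open>p \<circ> j = 0\<close> follow from the three given ones.
\<close>

definition has_biproducts :: "('o, 'm) cat \<Rightarrow> ('o \<Rightarrow> 'o \<Rightarrow> 'm monoid) \<Rightarrow> bool" where
  "has_biproducts C H \<longleftrightarrow>
     (\<forall>X \<in> Obj C. \<forall>Y \<in> Obj C. \<exists>B \<in> Obj C.
        \<exists>i \<in> Hom C X B. \<exists>j \<in> Hom C Y B. \<exists>p \<in> Hom C B X. \<exists>q \<in> Hom C B Y.
          Comp C p i = Id C X \<and> Comp C q j = Id C Y \<and>
          Comp C i p \<otimes>\<^bsub>H B B\<^esub> Comp C j q = Id C B)"

definition abelian_category :: "('o, 'm) cat \<Rightarrow> bool" where
  "abelian_category C \<longleftrightarrow>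
     (\<exists>H. preadditive C H \<and> has_biproducts C H) \<and>
     (\<exists>Z. zero_obj C Z) \<and>
     (\<forall>f \<in> Arr C. (\<exists>k. is_kernel C f k) \<and> (\<exists>c. is_cokernel C f c)) \<and>
     (\<forall>f. monic C f \<longrightarrow> (\<exists>g. is_kernel C g f)) \<and>
     (\<forall>f. epic C f \<longrightarrow> (\<exists>g. is_cokernel C g f))"

section \<open>The functor category\<close>

record ('o, 'm, 'p, 'q) nat_trans =
  source :: "('o, 'm, 'p, 'q) fctr"
  target :: "('o, 'm, 'p, 'q) fctr"
  component :: "'o \<Rightarrow> 'q"

text \<open>
  Functors and families of components are normalised to be extensional, that is \<open>undefined\<close>
  outside the objects and arrows of the index category, so that equality in HOL is equality of
  functors and of natural transformations.
\<close>

definition functors :: "('o, 'm) cat \<Rightarrow> ('p, 'q) cat \<Rightarrow> ('o, 'm, 'p, 'q) fctr set" where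
  "functors S A = {F. is_functor S A F \<and> on_obj F \<in> extensional (Obj S) \<and>
     on_arr F \<in> extensional (Arr S)}"

definition nat_transs :: "('o, 'm) cat \<Rightarrow> ('p, 'q) cat \<Rightarrow> ('o, 'm, 'p, 'q) nat_trans set" where
  "nat_transs S A = {t. source t \<in> functors S A \<and> target t \<in> functors S A \<and>
     component t \<in> extensional (Obj S) \<and>
     (\<forall>s \<in> Obj S. component t s \<in> Hom A (on_obj (source t) s) (on_obj (target t) s)) \<and>
     (\<forall>a \<in> Arr S. Comp A (component t (Cod S a)) (on_arr (source t) a) =
                  Comp A (on_arr (target t) a) (component t (Dom S a)))}"

definition Fun ::
  "('o, 'm) cat \<Rightarrow> ('p, 'q) cat \<Rightarrow> (('o, 'm, 'p, 'q) fctr, ('o, 'm, 'p, 'q) nat_trans) cat" where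
  "Fun S A = \<lparr>
     Obj = functors S A,
     Arr = nat_transs S A,
     Dom = source,
     Cod = target,
     Id = (\<lambda>F. \<lparr>source = F, target = F, component = (\<lambda>s\<in>Obj S. Id A (on_obj F s))\<rparr>),
     Comp = (\<lambda>t r. \<lparr>source = source r, target = target t,
                    component = (\<lambda>s\<in>Obj S. Comp A (component t s) (component r s))\<rparr>)\<rparr>"

definition const_diag ::
  "('o, 'm) cat \<Rightarrow> ('p, 'q) cat \<Rightarrow> ('p, 'q, ('o, 'm, 'p, 'q) fctr, ('o, 'm, 'p, 'q) nat_trans) fctr"
  where
  "const_diag S A =
     (let \<kappa> = (\<lambda>X. \<lparr>on_obj = (\<lambda>s\<in>Obj S. X), on_arr = (\<lambda>a\<in>Arr S. Id A X)\<rparr>)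
      in \<lparr>on_obj = \<kappa>,
          on_arr = (\<lambda>f. \<lparr>source = \<kappa> (Dom A f), target = \<kappa> (Cod A f),
                         component = (\<lambda>s\<in>Obj S. f)\<rparr>)\<rparr>)"

section \<open>Colimits over an index category\<close>

definition is_colimit ::
  "('o, 'm) cat \<Rightarrow> ('p, 'q) cat \<Rightarrow> ('o, 'm, 'p, 'q) fctr \<Rightarrow> 'p \<Rightarrow> ('o, 'm, 'p, 'q) nat_trans \<Rightarrow> bool"
  where
  "is_colimit S A F L \<rho> \<longleftrightarrow>
     L \<in> Obj A \<and> \<rho> \<in> Hom (Fun S A) F (on_obj (const_diag S A) L) \<and>
     (\<forall>X \<in> Obj A. \<forall>\<sigma> \<in> Hom (Fun S A) F (on_obj (const_diag S A) X).
        \<exists>!u. u \<in> Hom A L X \<and> Comp (Fun S A) (on_arr (const_diag S A) u) \<rho> = \<sigma>)"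

definition cocomplete :: "('o, 'm) cat \<Rightarrow> ('p, 'q) cat \<Rightarrow> bool" where
  "cocomplete S A \<longleftrightarrow> (\<forall>F \<in> functors S A. \<exists>L \<rho>. is_colimit S A F L \<rho>)"

text \<open>
  A fixed but unspecified choice of colimit for each diagram; the definite descriptions below are
  well defined when \<open>A\<close> is \<open>S\<close>-cocomplete, by the universal property.
\<close>

definition colimit ::
  "('o, 'm) cat \<Rightarrow> ('p, 'q) cat \<Rightarrow> ('o, 'm, 'p, 'q) fctr \<Rightarrow> 'p \<times> ('o, 'm, 'p, 'q) nat_trans" where
  "colimit S A F = (SOME (L, \<rho>). is_colimit S A F L \<rho>)"

definition colim_obj :: "('o, 'm) cat \<Rightarrow> ('p, 'q) cat \<Rightarrow> ('o, 'm, 'p, 'q) fctr \<Rightarrow> 'p" where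
  "colim_obj S A F = fst (colimit S A F)"

definition univ_trans ::
  "('o, 'm) cat \<Rightarrow> ('p, 'q) cat \<Rightarrow> ('o, 'm, 'p, 'q) fctr \<Rightarrow> ('o, 'm, 'p, 'q) nat_trans" where
  "univ_trans S A F = snd (colimit S A F)"

definition colim_arr :: "('o, 'm) cat \<Rightarrow> ('p, 'q) cat \<Rightarrow> ('o, 'm, 'p, 'q) nat_trans \<Rightarrow> 'q" where
  "colim_arr S A t =
     (THE u. u \<in> Hom A (colim_obj S A (source t)) (colim_obj S A (target t)) \<and>
        Comp (Fun S A) (on_arr (const_diag S A) u) (univ_trans S A (source t)) =
        Comp (Fun S A) (univ_trans S A (target t)) t)"

definition colim ::
  "('o, 'm) cat \<Rightarrow> ('p, 'q) cat \<Rightarrow> (('o, 'm, 'p, 'q) fctr, ('o, 'm, 'p, 'q) nat_trans, 'p, 'q) fctr"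
  where
  "colim S A = \<lparr>on_obj = colim_obj S A, on_arr = colim_arr S A\<rparr>"

definition codiagonal :: "('o, 'm) cat \<Rightarrow> ('p, 'q) cat \<Rightarrow> 'p \<Rightarrow> 'q" where
  "codiagonal S A X =
     (let \<kappa>X = on_obj (const_diag S A) X
      in THE d. d \<in> Hom A (colim_obj S A \<kappa>X) X \<and>
           Comp (Fun S A) (on_arr (const_diag S A) d) (univ_trans S A \<kappa>X) = Id (Fun S A) \<kappa>X)"

text \<open>
  For a short exact sequence \<open>0 \<rightarrow> \<kappa>(X) \<rightarrow> F \<rightarrow> G \<rightarrow> 0\<close> with first map \<open>\<phi>\<close>, the chosen pushout of
  \<open>colim(\<phi>)\<close> and the codiagonal of \<open>X\<close>. It depends on the sequence only through \<open>X\<close> and \<open>\<phi>\<close>.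
\<close>

definition eta_pushout ::
  "('o, 'm) cat \<Rightarrow> ('p, 'q) cat \<Rightarrow> 'p \<Rightarrow> ('o, 'm, 'p, 'q) nat_trans \<Rightarrow> 'q \<times> 'q" where
  "eta_pushout S A X \<phi> =
     (SOME (\<mu>, f). is_pushout A (on_arr (colim S A) \<phi>) (codiagonal S A X) \<mu> f)"

definition f_eta ::
  "('o, 'm) cat \<Rightarrow> ('p, 'q) cat \<Rightarrow> 'p \<Rightarrow> ('o, 'm, 'p, 'q) nat_trans \<Rightarrow> 'q" where
  "f_eta S A X \<phi> = snd (eta_pushout S A X \<phi>)"

end

theory Submission
  imports Defs
begin

text \<open>
  The colimit is left adjoint to the constant diagram functor \<open>\<kappa>\<close>, hence right exact, so exactness
  means that it preserves monomorphisms. If it does, \<open>f\<^sub>\<eta>\<close> is a pushout of the monomorphism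
  \<open>colim(\<phi>)\<close>. Conversely, push a monomorphism \<open>\<phi> : F \<rightarrow> G\<close> out along \<open>\<rho>\<^sup>F : F \<rightarrow> \<kappa>(C\<^sub>F)\<close> to get
  \<open>\<phi>' : \<kappa>(C\<^sub>F) \<rightarrow> P\<close> and \<open>\<nu> : G \<rightarrow> P\<close>. The codiagonal of \<open>C\<^sub>F\<close> splits \<open>colim(\<rho>\<^sup>F)\<close>, so the
  morphism \<open>f\<^sub>\<eta>\<close> attached to \<open>\<phi>'\<close> factors as \<open>\<mu>\<^sub>\<eta> \<circ> colim(\<nu>) \<circ> colim(\<phi>)\<close>; if it is monic, so is
  \<open>colim(\<phi>)\<close>.
\<close>

text \<open>Condition (b) only concerns sequences that start in a constant diagram. Pushing out
  along \<open>\<rho> F\<close> makes the source constant without losing information: the codiagonal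
  is the counit of the adjunction and \<open>\<rho> F\<close> the unit, so the retraction of
  \<open>colim(\<rho> F)\<close> is a triangle identity.

  The obstacle is that monomorphisms and short exactness in \<open>Fun S A\<close> are defined by
  universal properties inside \<open>Fun S A\<close>, while the constructions are available in
  \<open>A\<close>. The bridge is to build pushouts, cokernels and kernels objectwise. A
  monomorphism of functors then has a zero objectwise kernel, hence monic components, and these stay
  monic under an objectwise pushout. Addition of arrows is used only in \<open>A\<close>; in the
  functor category the zero arrows coming from a zero object suffice. Passing from \<open>S\<close>
  and \<open>A\<close> to their opposites exchanges kernels with cokernels and monomorphisms with
  epimorphisms.\<close>

notation Comp (infixr "\<cdot>\<index>" 70)

section \<open>Rules for the universal properties, with explicit domains and codomains\<close>

lemma Hom_D:
  assumes "f \<in> Hom C X Y"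
  shows "f \<in> Arr C" "Dom C f = X" "Cod C f = Y"
  using assms by (auto simp: Hom_def)

lemma Arr_Hom: "f \<in> Arr C \<Longrightarrow> f \<in> Hom C (Dom C f) (Cod C f)"
  by (simp add: Hom_def)

lemma zero_obj_arrow_unique:
  assumes "zero_obj C Z" "X \<in> Obj C"
  shows "f \<in> Hom C X Z \<Longrightarrow> g \<in> Hom C X Z \<Longrightarrow> f = g"
    and "f \<in> Hom C Z X \<Longrightarrow> g \<in> Hom C Z X \<Longrightarrow> f = g"
  using assms unfolding zero_obj_def by blast+

lemma zero_obj_Obj: "zero_obj C Z \<Longrightarrow> Z \<in> Obj C"
  by (simp add: zero_obj_def)

lemma zero_obj_arrow_exists:
  assumes "zero_obj C Z" "X \<in> Obj C"
  shows "\<exists>f. f \<in> Hom C X Z" and "\<exists>f. f \<in> Hom C Z X"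
  using assms unfolding zero_obj_def by (meson ex1_implies_ex)+

lemma monicD:
  "monic C f \<Longrightarrow> f \<in> Hom C X Y \<Longrightarrow> g \<in> Hom C W X \<Longrightarrow> h \<in> Hom C W X \<Longrightarrow>
    f \<cdot>\<^bsub>C\<^esub> g = f \<cdot>\<^bsub>C\<^esub> h \<Longrightarrow> g = h"
  unfolding monic_def Hom_def by auto

lemma epicD:
  "epic C f \<Longrightarrow> f \<in> Hom C X Y \<Longrightarrow> g \<in> Hom C Y W \<Longrightarrow> h \<in> Hom C Y W \<Longrightarrow>
    g \<cdot>\<^bsub>C\<^esub> f = h \<cdot>\<^bsub>C\<^esub> f \<Longrightarrow> g = h"
  unfolding epic_def Hom_def by auto

lemma monicI:
  assumes "f \<in> Hom C X Y"
    and "\<And>W g h. g \<in> Hom C W X \<Longrightarrow> h \<in> Hom C W X \<Longrightarrow> f \<cdot>\<^bsub>C\<^esub> g = f \<cdot>\<^bsub>C\<^esub> h \<Longrightarrow> g = h"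
  shows "monic C f"
  using assms unfolding monic_def Hom_def by auto

lemma epicI:
  assumes "f \<in> Hom C X Y"
    and "\<And>W g h. g \<in> Hom C Y W \<Longrightarrow> h \<in> Hom C Y W \<Longrightarrow> g \<cdot>\<^bsub>C\<^esub> f = h \<cdot>\<^bsub>C\<^esub> f \<Longrightarrow> g = h"
  shows "epic C f"
  using assms unfolding epic_def Hom_def by auto

lemma is_kernelD:
  assumes "is_kernel C f k" "f \<in> Hom C X Y"
  shows "k \<in> Hom C (Dom C k) X" "zero_arr C (f \<cdot>\<^bsub>C\<^esub> k)"
  using assms unfolding is_kernel_def Hom_def by auto

lemma is_kernel_ex1:
  assumes "is_kernel C f k" "f \<in> Hom C X Y" "h \<in> Hom C W X" "zero_arr C (f \<cdot>\<^bsub>C\<^esub> h)"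
  shows "\<exists>!u. u \<in> Hom C W (Dom C k) \<and> k \<cdot>\<^bsub>C\<^esub> u = h"
proof -
  have "\<forall>h \<in> Arr C. Cod C h = Dom C f \<and> zero_arr C (f \<cdot>\<^bsub>C\<^esub> h) \<longrightarrow>
      (\<exists>!u. u \<in> Hom C (Dom C h) (Dom C k) \<and> k \<cdot>\<^bsub>C\<^esub> u = h)"
    using assms(1) unfolding is_kernel_def by (elim conjE)
  from this[rule_format, of h] show ?thesis
    using assms(4) Hom_D[OF assms(3)] Hom_D(2)[OF assms(2)] by simp
qed

lemma is_kernel_factor:
  assumes "is_kernel C f k" "f \<in> Hom C X Y" "h \<in> Hom C W X" "zero_arr C (f \<cdot>\<^bsub>C\<^esub> h)"
  obtains u where "u \<in> Hom C W (Dom C k)" "k \<cdot>\<^bsub>C\<^esub> u = h"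
  using is_kernel_ex1[OF assms] by blast

text \<open>Monicity of \<open>k\<close> takes over the uniqueness of factorizations, so that only
  their existence remains to be checked.\<close>

lemma is_kernelI:
  assumes "f \<in> Hom C X Y" "k \<in> Hom C K X" "zero_arr C (f \<cdot>\<^bsub>C\<^esub> k)" "monic C k"
    and "\<And>W h. h \<in> Hom C W X \<Longrightarrow> zero_arr C (f \<cdot>\<^bsub>C\<^esub> h) \<Longrightarrow> \<exists>u \<in> Hom C W K. k \<cdot>\<^bsub>C\<^esub> u = h"
  shows "is_kernel C f k"
proof -
  have "\<exists>!u. u \<in> Hom C (Dom C h) (Dom C k) \<and> k \<cdot>\<^bsub>C\<^esub> u = h"
    if "h \<in> Arr C" "Cod C h = Dom C f" "zero_arr C (f \<cdot>\<^bsub>C\<^esub> h)" for h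
  proof -
    have "h \<in> Hom C (Dom C h) X" using that assms(1) by (auto simp: Hom_def)
    with assms(5) that(3) obtain u where u: "u \<in> Hom C (Dom C h) K" "k \<cdot>\<^bsub>C\<^esub> u = h" by blast
    moreover have "v = u" if "v \<in> Hom C (Dom C h) K" "k \<cdot>\<^bsub>C\<^esub> v = h" for v
      using monicD[OF assms(4,2) that(1) u(1)] that(2) u(2) by simp
    ultimately show ?thesis using Hom_D(2)[OF assms(2)] by blast
  qed
  then show ?thesis using assms(1-3) unfolding is_kernel_def by (auto simp: Hom_def)
qed

lemma is_pushoutD:
  assumes "is_pushout C a b m f" "a \<in> Hom C P Y" "b \<in> Hom C P X"
  shows "m \<in> Hom C Y (Cod C m)" "f \<in> Hom C X (Cod C m)" "m \<cdot>\<^bsub>C\<^esub> a = f \<cdot>\<^bsub>C\<^esub> b"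
  using assms unfolding is_pushout_def Hom_def by auto

lemma is_pushout_factor:
  assumes "is_pushout C a b m f" "a \<in> Hom C P Y" "b \<in> Hom C P X"
    and "x \<in> Hom C Y W" "y \<in> Hom C X W" "x \<cdot>\<^bsub>C\<^esub> a = y \<cdot>\<^bsub>C\<^esub> b"
  shows "\<exists>!u. u \<in> Hom C (Cod C m) W \<and> u \<cdot>\<^bsub>C\<^esub> m = x \<and> u \<cdot>\<^bsub>C\<^esub> f = y"
proof -
  have "\<forall>W. \<forall>x \<in> Hom C (Cod C a) W. \<forall>y \<in> Hom C (Cod C b) W. x \<cdot>\<^bsub>C\<^esub> a = y \<cdot>\<^bsub>C\<^esub> b \<longrightarrow>
      (\<exists>!u. u \<in> Hom C (Cod C m) W \<and> u \<cdot>\<^bsub>C\<^esub> m = x \<and> u \<cdot>\<^bsub>C\<^esub> f = y)"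
    using assms(1) unfolding is_pushout_def by (elim conjE)
  from this[rule_format, of x W y] show ?thesis
    using assms(4-6) Hom_D(3)[OF assms(2)] Hom_D(3)[OF assms(3)] by simp
qed

subsection \<open>Opposite categories\<close>

text \<open>Being an involution up to equality of records, this lets facts be dualised by mere
  instantiation, without transport along an isomorphism.\<close>

definition opposite :: "('o, 'm) cat \<Rightarrow> ('o, 'm) cat" where
  "opposite C = \<lparr>Obj = Obj C, Arr = Arr C, Dom = Cod C, Cod = Dom C, Id = Id C,
    Comp = (\<lambda>g f. f \<cdot>\<^bsub>C\<^esub> g)\<rparr>"

lemma opposite_simps [simp]:
  "Obj (opposite C) = Obj C" "Arr (opposite C) = Arr C" "Dom (opposite C) = Cod C"
  "Cod (opposite C) = Dom C" "Id (opposite C) = Id C" "g \<cdot>\<^bsub>opposite C\<^esub> f = f \<cdot>\<^bsub>C\<^esub> g"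
  by (simp_all add: opposite_def)

lemma opposite_opposite [simp]: "opposite (opposite C) = C"
  by (simp add: opposite_def)

lemma Hom_opposite [simp]: "Hom (opposite C) X Y = Hom C Y X"
  by (auto simp: Hom_def)

lemma monic_opposite [simp]: "monic (opposite C) f \<longleftrightarrow> epic C f"
  by (simp add: monic_def epic_def)

lemma epic_opposite [simp]: "epic (opposite C) f \<longleftrightarrow> monic C f"
  by (simp add: monic_def epic_def)

lemma zero_obj_opposite [simp]: "zero_obj (opposite C) Z \<longleftrightarrow> zero_obj C Z"
  by (auto simp: zero_obj_def)

lemma zero_arr_opposite [simp]: "zero_arr (opposite C) f \<longleftrightarrow> zero_arr C f"
  unfolding zero_arr_def by auto

lemma is_kernel_opposite [simp]: "is_kernel (opposite C) = is_cokernel C"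
  by (intro ext) (simp add: is_kernel_def is_cokernel_def)

lemma is_cokernel_opposite [simp]: "is_cokernel (opposite C) = is_kernel C"
  by (intro ext) (simp add: is_kernel_def is_cokernel_def)

lemmas is_cokernelD =
  is_kernelD[of "opposite C" for C, unfolded is_kernel_opposite Hom_opposite opposite_simps
    zero_arr_opposite]
lemmas is_cokernel_factor =
  is_kernel_factor[of "opposite C" for C, unfolded is_kernel_opposite Hom_opposite opposite_simps
    zero_arr_opposite]
lemmas is_cokernelI =
  is_kernelI[of _ "opposite C" for C, unfolded is_kernel_opposite Hom_opposite opposite_simps
    zero_arr_opposite monic_opposite]

lemma category_opposite: "category C \<Longrightarrow> category (opposite C)"
  by (rule category.intro)
    (simp_all add: category.Dom_in category.Cod_in category.Id_in category.Comp_in category.Comp_Id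
      category.Id_Comp category.Comp_assoc)

subsection \<open>Zero arrows, kernels and cokernels\<close>

context category
begin

lemma Hom_Obj: "f \<in> Hom C X Y \<Longrightarrow> X \<in> Obj C" "f \<in> Hom C X Y \<Longrightarrow> Y \<in> Obj C"
  using Dom_in Cod_in by (auto simp: Hom_def)

lemma zero_arrI:
  assumes "zero_obj C Z" "u \<in> Hom C X Z" "v \<in> Hom C Z Y"
  shows "zero_arr C (v \<cdot>\<^bsub>C\<^esub> u)"
  unfolding zero_arr_def using Hom_D[OF Comp_in[OF assms(2,3)]] assms
  by (intro conjI exI[of _ Z] exI[of _ u] exI[of _ v]) simp_all

lemma zero_arrE:
  assumes "zero_arr C f" "f \<in> Hom C X Y"
  obtains Z u v where "zero_obj C Z" "u \<in> Hom C X Z" "v \<in> Hom C Z Y" "f = v \<cdot>\<^bsub>C\<^esub> u"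
  using assms that unfolding zero_arr_def Hom_def by auto

text \<open>The two factorizations may use different zero objects. An arrow \<open>w\<close> between
  these objects turns both composites into the same arrow through \<open>Z\<close> and
  \<open>Z'\<close>.\<close>

lemma zero_arr_unique:
  assumes f: "zero_arr C f" "f \<in> Hom C X Y" and g: "zero_arr C g" "g \<in> Hom C X Y"
  shows "f = g"
proof -
  obtain Z u v where 1: "zero_obj C Z" "u \<in> Hom C X Z" "v \<in> Hom C Z Y" "f = v \<cdot>\<^bsub>C\<^esub> u"
    by (rule zero_arrE[OF f])
  obtain Z' u' v' where 2: "zero_obj C Z'" "u' \<in> Hom C X Z'" "v' \<in> Hom C Z' Y" "g = v' \<cdot>\<^bsub>C\<^esub> u'"
    by (rule zero_arrE[OF g])
  obtain w where w: "w \<in> Hom C Z Z'" using zero_obj_arrow_exists(1)[OF 2(1) zero_obj_Obj[OF 1(1)]] by blast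
  have "v = v' \<cdot>\<^bsub>C\<^esub> w"
    using zero_obj_arrow_unique(2)[OF 1(1) Hom_Obj(2)[OF f(2)] 1(3) Comp_in[OF w 2(3)]] .
  moreover have "u' = w \<cdot>\<^bsub>C\<^esub> u"
    using zero_obj_arrow_unique(1)[OF 2(1) Hom_Obj(1)[OF f(2)] 2(2) Comp_in[OF 1(2) w]] .
  ultimately show ?thesis using 1(4) 2(4) Comp_assoc[OF 1(2) w 2(3)] by simp
qed

lemma zero_comp:
  assumes "zero_arr C f" "f \<in> Hom C X Y" "g \<in> Hom C Y W"
  shows "zero_arr C (g \<cdot>\<^bsub>C\<^esub> f)"
proof -
  obtain Z u v where 1: "zero_obj C Z" "u \<in> Hom C X Z" "v \<in> Hom C Z Y" "f = v \<cdot>\<^bsub>C\<^esub> u"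
    by (rule zero_arrE[OF assms(1,2)])
  show ?thesis
    using zero_arrI[OF 1(1,2) Comp_in[OF 1(3) assms(3)]] Comp_assoc[OF 1(2,3) assms(3)] 1(4) by simp
qed

lemma comp_zero:
  assumes "zero_arr C g" "f \<in> Hom C X Y" "g \<in> Hom C Y W"
  shows "zero_arr C (g \<cdot>\<^bsub>C\<^esub> f)"
  using category.zero_comp[OF category_opposite[OF category_axioms]] assms by auto

lemma zero_arr_exists:
  assumes "zero_obj C Z" "X \<in> Obj C" "Y \<in> Obj C"
  obtains f where "f \<in> Hom C X Y" "zero_arr C f"
proof -
  obtain u v where "u \<in> Hom C X Z" "v \<in> Hom C Z Y"
    using zero_obj_arrow_exists[OF assms(1)] assms by blast
  then show thesis using that[OF Comp_in zero_arrI[OF assms(1)]] by blast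
qed

text \<open>Both arrows solve the factorization problem posed by the cocone of \<open>v\<close>. The
  functor laws of objectwise pushouts will rest on this.\<close>

lemma pushout_jointly_epic:
  assumes "is_pushout C a b m f" "a \<in> Hom C P Y" "b \<in> Hom C P X"
    and "u \<in> Hom C (Cod C m) W" "v \<in> Hom C (Cod C m) W"
    and "u \<cdot>\<^bsub>C\<^esub> m = v \<cdot>\<^bsub>C\<^esub> m" "u \<cdot>\<^bsub>C\<^esub> f = v \<cdot>\<^bsub>C\<^esub> f"
  shows "u = v"
proof -
  note D = is_pushoutD[OF assms(1-3)]
  have "(v \<cdot>\<^bsub>C\<^esub> m) \<cdot>\<^bsub>C\<^esub> a = (v \<cdot>\<^bsub>C\<^esub> f) \<cdot>\<^bsub>C\<^esub> b"
    using Comp_assoc[OF assms(2) D(1) assms(5)] Comp_assoc[OF assms(3) D(2) assms(5)] D(3) by simp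
  then have "\<exists>!w. w \<in> Hom C (Cod C m) W \<and> w \<cdot>\<^bsub>C\<^esub> m = v \<cdot>\<^bsub>C\<^esub> m \<and> w \<cdot>\<^bsub>C\<^esub> f = v \<cdot>\<^bsub>C\<^esub> f"
    using is_pushout_factor[OF assms(1-3) Comp_in[OF D(1) assms(5)] Comp_in[OF D(2) assms(5)]] by simp
  then show ?thesis using assms(4-7) by metis
qed

lemma is_kernel_monic:
  assumes "is_kernel C f k"
  shows "monic C k"
proof -
  have f: "f \<in> Hom C (Dom C f) (Cod C f)" using assms by (simp add: is_kernel_def Hom_def)
  note k = is_kernelD[OF assms f]
  show ?thesis
  proof (rule monicI[OF k(1)])
    fix W g h assume gh: "g \<in> Hom C W (Dom C k)" "h \<in> Hom C W (Dom C k)" "k \<cdot>\<^bsub>C\<^esub> g = k \<cdot>\<^bsub>C\<^esub> h"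
    have kg: "k \<cdot>\<^bsub>C\<^esub> g \<in> Hom C W (Dom C f)" using Comp_in[OF gh(1) k(1)] .
    have "zero_arr C (f \<cdot>\<^bsub>C\<^esub> (k \<cdot>\<^bsub>C\<^esub> g))"
      using comp_zero[OF k(2) gh(1) Comp_in[OF k(1) f]] Comp_assoc[OF gh(1) k(1) f] by simp
    then have "\<exists>!u. u \<in> Hom C W (Dom C k) \<and> k \<cdot>\<^bsub>C\<^esub> u = k \<cdot>\<^bsub>C\<^esub> g"
      using is_kernel_ex1[OF assms f kg] by blast
    then show "g = h" using gh by metis
  qed
qed

text \<open>Since \<open>g\<close> kills \<open>f\<close>, it factors through \<open>c\<close>;
  hence whatever \<open>c\<close> kills is killed by \<open>g\<close> and so factors through
  \<open>f\<close>. This sharpens the abelian axiom "a monomorphism is some kernel" to "it is the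
  kernel of its cokernel".\<close>

lemma is_kernel_of_cokernel:
  assumes "is_kernel C g f" "is_cokernel C f c"
  shows "is_kernel C c f"
proof -
  have g: "g \<in> Hom C (Dom C g) (Cod C g)" using assms by (simp add: is_kernel_def Hom_def)
  note f = is_kernelD[OF assms(1) g]
  note c = is_cokernelD[OF assms(2) f(1)]
  obtain v where v: "v \<in> Hom C (Cod C c) (Cod C g)" "v \<cdot>\<^bsub>C\<^esub> c = g"
    by (rule is_cokernel_factor[OF assms(2) f(1) g f(2)])
  show ?thesis
  proof (rule is_kernelI[OF c(1) f(1) c(2) is_kernel_monic[OF assms(1)]])
    fix W h assume h: "h \<in> Hom C W (Dom C g)" "zero_arr C (c \<cdot>\<^bsub>C\<^esub> h)"
    have "zero_arr C (g \<cdot>\<^bsub>C\<^esub> h)"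
      using zero_comp[OF h(2) Comp_in[OF h(1) c(1)] v(1)] Comp_assoc[OF h(1) c(1) v(1)] v(2) by simp
    then show "\<exists>u\<in>Hom C W (Dom C f). f \<cdot>\<^bsub>C\<^esub> u = h" using is_kernel_factor[OF assms(1) g h(1)] by blast
  qed
qed

lemma is_cokernel_epic: "is_cokernel C f c \<Longrightarrow> epic C c"
  using category.is_kernel_monic[OF category_opposite[OF category_axioms]] by simp

lemma is_cokernel_of_kernel: "is_cokernel C g f \<Longrightarrow> is_kernel C f k \<Longrightarrow> is_cokernel C k f"
  using category.is_kernel_of_cokernel[OF category_opposite[OF category_axioms]] by simp

text \<open>Both \<open>g\<close> and the cokernel of \<open>f\<close> are cokernels of the image of \<open>f\<close>.\<close>

lemma short_exact_is_cokernel: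
  assumes "short_exact C f g" "is_cokernel C e g"
  shows "is_cokernel C f g"
proof -
  obtain c m where cm: "is_cokernel C f c" "is_kernel C c m" "is_kernel C g m"
    using assms(1) unfolding short_exact_def exact_at_def is_image_def by blast
  have c1: "is_cokernel C m c" using is_cokernel_of_kernel cm by blast
  have g1: "is_cokernel C m g" using is_cokernel_of_kernel cm assms by blast
  have f: "f \<in> Hom C (Dom C f) (Cod C f)" using cm by (simp add: is_cokernel_def Hom_def)
  note c = is_cokernelD[OF cm(1) f]
  have m: "m \<in> Hom C (Dom C m) (Cod C f)" using is_kernelD(1)[OF cm(2) c(1)] .
  note g = is_cokernelD[OF g1 m]
  obtain u where u: "u \<in> Hom C (Cod C c) (Cod C g)" "u \<cdot>\<^bsub>C\<^esub> c = g"
    by (rule is_cokernel_factor[OF c1 m g])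
  obtain v where v: "v \<in> Hom C (Cod C g) (Cod C c)" "v \<cdot>\<^bsub>C\<^esub> g = c"
    by (rule is_cokernel_factor[OF g1 m c(1)]) (use is_cokernelD[OF c1 m] in auto)
  show ?thesis
  proof (rule is_cokernelI[OF f g(1)])
    show "zero_arr C (g \<cdot>\<^bsub>C\<^esub> f)"
      using zero_comp[OF c(2) Comp_in[OF f c(1)] u(1)] Comp_assoc[OF f c(1) u(1)] u(2) by simp
    show "epic C g" using is_cokernel_epic[OF g1] .
    fix W h assume h: "h \<in> Hom C (Cod C f) W" "zero_arr C (h \<cdot>\<^bsub>C\<^esub> f)"
    obtain w where w: "w \<in> Hom C (Cod C c) W" "w \<cdot>\<^bsub>C\<^esub> c = h" by (rule is_cokernel_factor[OF cm(1) f h])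
    then have "(w \<cdot>\<^bsub>C\<^esub> v) \<cdot>\<^bsub>C\<^esub> g = h" using v Comp_assoc[OF g(1) v(1) w(1)] by simp
    then show "\<exists>u\<in>Hom C (Cod C g) W. u \<cdot>\<^bsub>C\<^esub> g = h" using Comp_in[OF v(1) w(1)] by blast
  qed
qed

end

subsection \<open>Abelian categories\<close>

text \<open>\<open>abelian_category\<close> only asserts that hom groups exist; here a choice
  \<open>H\<close> is fixed. In the multiplicative notation \<open>\<one>\<close> is the zero arrow
  and \<open>inv\<close> is negation.\<close>

locale preadditive_category = category C for C :: "('o, 'm) cat" +
  fixes H :: "'o \<Rightarrow> 'o \<Rightarrow> 'm monoid"
  assumes preadditive: "preadditive C H"
    and zero_obj_exists: "\<exists>Z. zero_obj C Z"
begin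

lemma hom_group: "X \<in> Obj C \<Longrightarrow> Y \<in> Obj C \<Longrightarrow> comm_group (H X Y)"
  and hom_carrier: "X \<in> Obj C \<Longrightarrow> Y \<in> Obj C \<Longrightarrow> carrier (H X Y) = Hom C X Y"
  using preadditive unfolding preadditive_def by auto

lemma comp_add:
  assumes "f \<in> Hom C X Y" "f' \<in> Hom C X Y" "g \<in> Hom C Y Z"
  shows "g \<cdot>\<^bsub>C\<^esub> (f \<otimes>\<^bsub>H X Y\<^esub> f') = (g \<cdot>\<^bsub>C\<^esub> f) \<otimes>\<^bsub>H X Z\<^esub> (g \<cdot>\<^bsub>C\<^esub> f')"
  using preadditive assms Hom_Obj[OF assms(1)] Hom_Obj[OF assms(3)] unfolding preadditive_def
  by simp

lemma add_comp:
  assumes "f \<in> Hom C X Y" "g \<in> Hom C Y Z" "g' \<in> Hom C Y Z"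
  shows "(g \<otimes>\<^bsub>H Y Z\<^esub> g') \<cdot>\<^bsub>C\<^esub> f = (g \<cdot>\<^bsub>C\<^esub> f) \<otimes>\<^bsub>H X Z\<^esub> (g' \<cdot>\<^bsub>C\<^esub> f)"
  using preadditive assms Hom_Obj[OF assms(1)] Hom_Obj[OF assms(3)] unfolding preadditive_def
  by simp

lemma add_in: "f \<in> Hom C X Y \<Longrightarrow> g \<in> Hom C X Y \<Longrightarrow> f \<otimes>\<^bsub>H X Y\<^esub> g \<in> Hom C X Y"
  using hom_group hom_carrier Hom_Obj comm_group.axioms(2) group.is_monoid monoid.m_closed by metis

lemma inv_in: "f \<in> Hom C X Y \<Longrightarrow> inv\<^bsub>H X Y\<^esub> f \<in> Hom C X Y"
  using hom_group hom_carrier Hom_Obj comm_group.axioms(2) group.inv_closed by metis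

lemma one_in: "X \<in> Obj C \<Longrightarrow> Y \<in> Obj C \<Longrightarrow> \<one>\<^bsub>H X Y\<^esub> \<in> Hom C X Y"
  using hom_group hom_carrier comm_group.axioms(2) group.is_monoid monoid.one_closed by metis

lemma add_one:
  assumes "f \<in> Hom C X Y"
  shows "f \<otimes>\<^bsub>H X Y\<^esub> \<one>\<^bsub>H X Y\<^esub> = f" "\<one>\<^bsub>H X Y\<^esub> \<otimes>\<^bsub>H X Y\<^esub> f = f"
  using assms hom_group[OF Hom_Obj[OF assms]] hom_carrier[OF Hom_Obj[OF assms]]
  by (simp_all add: comm_group_def group_def)

lemma add_inv: "f \<in> Hom C X Y \<Longrightarrow> f \<otimes>\<^bsub>H X Y\<^esub> inv\<^bsub>H X Y\<^esub> f = \<one>\<^bsub>H X Y\<^esub>"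
  using hom_group hom_carrier Hom_Obj comm_group.axioms(2) group.r_inv by metis

lemma add_inv_eq_one_iff:
  assumes "f \<in> Hom C X Y" "g \<in> Hom C X Y"
  shows "f \<otimes>\<^bsub>H X Y\<^esub> inv\<^bsub>H X Y\<^esub> g = \<one>\<^bsub>H X Y\<^esub> \<longleftrightarrow> f = g"
proof -
  interpret G: comm_group "H X Y" using hom_group[OF Hom_Obj[OF assms(1)]] .
  show ?thesis
    using assms hom_carrier[OF Hom_Obj[OF assms(1)]] G.inv_equality G.inv_inv G.inv_closed G.r_inv
    by metis
qed

lemma add_eq_self_imp:
  assumes "f \<in> Hom C X Y" "g \<in> Hom C X Y" "f \<otimes>\<^bsub>H X Y\<^esub> g = f"
  shows "g = \<one>\<^bsub>H X Y\<^esub>"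
proof -
  interpret G: comm_group "H X Y" using hom_group[OF Hom_Obj[OF assms(1)]] .
  show ?thesis
    using assms hom_carrier[OF Hom_Obj[OF assms(1)]] G.r_cancel_one' G.l_cancel_one' by metis
qed

text \<open>Composing \<open>g\<close> with \<open>0 + 0 = 0\<close> gives an element equal to its
  own double, which must be neutral.\<close>

lemma comp_one:
  assumes "X \<in> Obj C" "g \<in> Hom C Y Z"
  shows "g \<cdot>\<^bsub>C\<^esub> \<one>\<^bsub>H X Y\<^esub> = \<one>\<^bsub>H X Z\<^esub>"
proof -
  have 1: "\<one>\<^bsub>H X Y\<^esub> \<in> Hom C X Y" using one_in assms Hom_Obj by blast
  show ?thesis
    using add_eq_self_imp[OF Comp_in[OF 1 assms(2)] Comp_in[OF 1 assms(2)]] comp_add[OF 1 1 assms(2)]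
      add_one[OF 1] by simp
qed

lemma one_comp:
  assumes "Z \<in> Obj C" "f \<in> Hom C X Y"
  shows "\<one>\<^bsub>H Y Z\<^esub> \<cdot>\<^bsub>C\<^esub> f = \<one>\<^bsub>H X Z\<^esub>"
proof -
  have 1: "\<one>\<^bsub>H Y Z\<^esub> \<in> Hom C Y Z" using one_in assms Hom_Obj by blast
  show ?thesis
    using add_eq_self_imp[OF Comp_in[OF assms(2) 1] Comp_in[OF assms(2) 1]] add_comp[OF assms(2) 1 1]
      add_one[OF 1] by simp
qed

text \<open>Connects the two notions of zero: the neutral element equals \<open>v\<close> after the
  neutral arrow into a zero object, so it factors through that object, and zero arrows are
  unique.\<close>

lemma zero_arr_iff:
  assumes "f \<in> Hom C X Y"
  shows "zero_arr C f \<longleftrightarrow> f = \<one>\<^bsub>H X Y\<^esub>"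
proof -
  obtain Z where Z: "zero_obj C Z" using zero_obj_exists by blast
  note XY = Hom_Obj[OF assms]
  obtain v where v: "v \<in> Hom C Z Y" using zero_obj_arrow_exists[OF Z] XY by blast
  have "zero_arr C (v \<cdot>\<^bsub>C\<^esub> \<one>\<^bsub>H X Z\<^esub>)"
    using zero_arrI[OF Z _ v] one_in XY zero_obj_Obj[OF Z] by blast
  then have "zero_arr C \<one>\<^bsub>H X Y\<^esub>" using comp_one[OF XY(1) v] by simp
  then show ?thesis using zero_arr_unique[OF _ assms _ one_in[OF XY]] by blast
qed

lemma comp_diff:
  assumes "f \<in> Hom C X Y" "f' \<in> Hom C X Y" "g \<in> Hom C Y Z"
  shows "g \<cdot>\<^bsub>C\<^esub> (f \<otimes>\<^bsub>H X Y\<^esub> inv\<^bsub>H X Y\<^esub> f') = (g \<cdot>\<^bsub>C\<^esub> f) \<otimes>\<^bsub>H X Z\<^esub> inv\<^bsub>H X Z\<^esub> (g \<cdot>\<^bsub>C\<^esub> f')"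
proof -
  interpret G: comm_group "H X Z"
    using hom_group Hom_Obj[OF assms(1)] Hom_Obj[OF assms(3)] by blast
  have XZ: "carrier (H X Z) = Hom C X Z"
    using hom_carrier Hom_Obj[OF assms(1)] Hom_Obj[OF assms(3)] by blast
  note i = inv_in[OF assms(2)]
  have "(g \<cdot>\<^bsub>C\<^esub> f') \<otimes>\<^bsub>H X Z\<^esub> (g \<cdot>\<^bsub>C\<^esub> inv\<^bsub>H X Y\<^esub> f') = \<one>\<^bsub>H X Z\<^esub>"
    using comp_add[OF assms(2) i assms(3)] add_inv[OF assms(2)] comp_one[OF Hom_Obj(1)[OF assms(1)] assms(3)]
    by simp
  then have "g \<cdot>\<^bsub>C\<^esub> inv\<^bsub>H X Y\<^esub> f' = inv\<^bsub>H X Z\<^esub> (g \<cdot>\<^bsub>C\<^esub> f')"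
    using G.inv_equality G.m_comm Comp_in[OF i assms(3)] Comp_in[OF assms(2,3)] XZ by metis
  then show ?thesis using comp_add[OF assms(1) i assms(3)] by simp
qed

text \<open>The hypothesis is applied to the difference of two arrows that \<open>f\<close>
  identifies.\<close>

lemma monic_if_cancels_zero:
  assumes f: "f \<in> Hom C X Y"
    and "\<And>W g. g \<in> Hom C W X \<Longrightarrow> zero_arr C (f \<cdot>\<^bsub>C\<^esub> g) \<Longrightarrow> zero_arr C g"
  shows "monic C f"
proof (rule monicI[OF f])
  fix W g h assume gh: "g \<in> Hom C W X" "h \<in> Hom C W X" "f \<cdot>\<^bsub>C\<^esub> g = f \<cdot>\<^bsub>C\<^esub> h"
  let ?d = "g \<otimes>\<^bsub>H W X\<^esub> inv\<^bsub>H W X\<^esub> h"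
  have d: "?d \<in> Hom C W X" using gh add_in inv_in by blast
  have "f \<cdot>\<^bsub>C\<^esub> ?d = \<one>\<^bsub>H W Y\<^esub>"
    using comp_diff[OF gh(1,2) f] gh(3) add_inv[OF Comp_in[OF gh(2) f]] by simp
  then have "zero_arr C ?d" using assms(2)[OF d] zero_arr_iff[OF Comp_in[OF d f]] by blast
  then show "g = h" using zero_arr_iff[OF d] add_inv_eq_one_iff[OF gh(1,2)] by simp
qed

lemma kernel_zero_imp_monic:
  assumes f: "f \<in> Hom C X Y" and k: "is_kernel C f k" "zero_arr C k"
  shows "monic C f"
proof (rule monic_if_cancels_zero[OF f])
  fix W g assume "g \<in> Hom C W X" "zero_arr C (f \<cdot>\<^bsub>C\<^esub> g)"
  then obtain u where "u \<in> Hom C W (Dom C k)" "k \<cdot>\<^bsub>C\<^esub> u = g" by (rule is_kernel_factor[OF k(1) f])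
  then show "zero_arr C g" using comp_zero[OF k(2)] is_kernelD(1)[OF k(1) f] by blast
qed

lemma monic_cancels_zero:
  assumes "monic C f" "f \<in> Hom C X Y" "g \<in> Hom C W X" "zero_arr C (f \<cdot>\<^bsub>C\<^esub> g)"
  shows "zero_arr C g"
proof -
  note W = Hom_Obj(1)[OF assms(3)] and X = Hom_Obj(1)[OF assms(2)]
  have "f \<cdot>\<^bsub>C\<^esub> g = f \<cdot>\<^bsub>C\<^esub> \<one>\<^bsub>H W X\<^esub>"
    using assms zero_arr_iff[OF Comp_in[OF assms(3,2)]] comp_one[OF W assms(2)] by simp
  then show ?thesis
    using monicD[OF assms(1-3) one_in[OF W X]] zero_arr_iff[OF assms(3)] by simp
qed

end

section \<open>Kernels, cokernels and pushouts in an abelian category\<close>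

locale abelian = category C for C :: "('o, 'm) cat" +
  assumes abelian_category: "abelian_category C"

lemma abelian_iff: "abelian C \<longleftrightarrow> abelian_category C"
  unfolding abelian_def abelian_axioms_def abelian_category_def preadditive_def by blast

text \<open>The hom group at \<open>X\<close>, \<open>Y\<close> becomes the one at \<open>Y\<close>,
  \<open>X\<close>, and the injections and projections of a biproduct trade places.\<close>

lemma abelian_category_opposite:
  assumes "abelian_category C"
  shows "abelian_category (opposite C)"
proof -
  obtain H where H: "preadditive C H" "has_biproducts C H"
    using assms unfolding abelian_category_def by blast
  let ?H = "\<lambda>X Y. H Y X"
  have "preadditive (opposite C) ?H"
    using H(1) category_opposite[of C] unfolding preadditive_def by simp
  moreover have "has_biproducts (opposite C) ?H"
    using H(2) unfolding has_biproducts_def by (simp; meson)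
  ultimately show ?thesis using assms unfolding abelian_category_def by auto
qed

context abelian
begin

lemma opposite_abelian: "abelian (opposite C)"
  using abelian_category abelian_category_opposite abelian_iff by blast

lemma zero_obj_exists: "\<exists>Z. zero_obj C Z"
  using abelian_category unfolding abelian_category_def by blast

lemma preadditive_exists:
  obtains H where "preadditive_category C H" "has_biproducts C H"
  using abelian_category category_axioms
  unfolding abelian_category_def preadditive_category_def preadditive_category_axioms_def by blast

lemma kernel_exists:
  assumes "f \<in> Hom C X Y"
  obtains k where "is_kernel C f k"
  using abelian_category assms that unfolding abelian_category_def Hom_def by auto

lemma cokernel_exists:
  assumes "f \<in> Hom C X Y"
  obtains c where "is_cokernel C f c"
  using abelian_category assms that unfolding abelian_category_def Hom_def by auto

lemma monic_is_kernel:
  assumes "monic C f" "is_cokernel C f c"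
  shows "is_kernel C c f"
  using abelian_category assms is_kernel_of_cokernel unfolding abelian_category_def by blast

lemma epic_is_cokernel:
  assumes "epic C f" "is_kernel C f k"
  shows "is_cokernel C k f"
  using abelian_category assms is_cokernel_of_kernel unfolding abelian_category_def by blast

text \<open>The pushout is the cokernel of the difference \<open>d : P \<rightarrow> Y \<oplus> X\<close> of the two maps.\<close>

lemma pushout_exists:
  assumes a: "a \<in> Hom C P Y" and b: "b \<in> Hom C P X"
  obtains m f where "is_pushout C a b m f" "monic C a \<longrightarrow> monic C f"
proof -
  obtain H where H: "preadditive_category C H" "has_biproducts C H"
    by (rule preadditive_exists)
  interpret preadditive_category C H by (rule H)
  note Y = Hom_Obj(2)[OF a] and X = Hom_Obj(2)[OF b] and P = Hom_Obj(1)[OF a]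
  obtain B i j p q where B: "B \<in> Obj C" and i: "i \<in> Hom C Y B" and j: "j \<in> Hom C X B"
    and p: "p \<in> Hom C B Y" and q: "q \<in> Hom C B X"
    and pi: "p \<cdot>\<^bsub>C\<^esub> i = Id C Y" and qj: "q \<cdot>\<^bsub>C\<^esub> j = Id C X"
    and sum: "(i \<cdot>\<^bsub>C\<^esub> p) \<otimes>\<^bsub>H B B\<^esub> (j \<cdot>\<^bsub>C\<^esub> q) = Id C B"
    using H(2) X Y unfolding has_biproducts_def by meson
  note ip = Comp_in[OF p i] and jq = Comp_in[OF q j]
  \<comment> \<open>The missing biproduct equations: composing \<open>ip + jq = 1\<close> with
    \<open>i\<close> and cancelling \<open>i\<close> leaves \<open>jqi = 0\<close>, and applying
    \<open>q\<close> gives \<open>qi = 0\<close>. The case of \<open>pj\<close> is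
    symmetric.\<close>
  have "i = ((i \<cdot>\<^bsub>C\<^esub> p) \<otimes>\<^bsub>H B B\<^esub> (j \<cdot>\<^bsub>C\<^esub> q)) \<cdot>\<^bsub>C\<^esub> i" using sum Id_Comp[OF i] by simp
  also have "\<dots> = i \<otimes>\<^bsub>H Y B\<^esub> ((j \<cdot>\<^bsub>C\<^esub> q) \<cdot>\<^bsub>C\<^esub> i)"
    using add_comp[OF i ip jq] Comp_assoc[OF i p i] pi Comp_Id[OF i] by simp
  finally have "(j \<cdot>\<^bsub>C\<^esub> q) \<cdot>\<^bsub>C\<^esub> i = \<one>\<^bsub>H Y B\<^esub>" using add_eq_self_imp[OF i Comp_in[OF i jq]] by simp
  then have "q \<cdot>\<^bsub>C\<^esub> (j \<cdot>\<^bsub>C\<^esub> (q \<cdot>\<^bsub>C\<^esub> i)) = \<one>\<^bsub>H Y X\<^esub>"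
    using comp_one[OF Y q] Comp_assoc[OF i q j] by simp
  then have qi: "q \<cdot>\<^bsub>C\<^esub> i = \<one>\<^bsub>H Y X\<^esub>"
    using Comp_assoc[OF Comp_in[OF i q] j q] qj Id_Comp[OF Comp_in[OF i q]] by simp
  have "j = ((i \<cdot>\<^bsub>C\<^esub> p) \<otimes>\<^bsub>H B B\<^esub> (j \<cdot>\<^bsub>C\<^esub> q)) \<cdot>\<^bsub>C\<^esub> j" using sum Id_Comp[OF j] by simp
  also have "\<dots> = ((i \<cdot>\<^bsub>C\<^esub> p) \<cdot>\<^bsub>C\<^esub> j) \<otimes>\<^bsub>H X B\<^esub> j"
    using add_comp[OF j ip jq] Comp_assoc[OF j q j] qj Comp_Id[OF j] by simp
  finally have "(i \<cdot>\<^bsub>C\<^esub> p) \<cdot>\<^bsub>C\<^esub> j = \<one>\<^bsub>H X B\<^esub>"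
    using add_eq_self_imp[OF j Comp_in[OF j ip]] comm_monoid.m_comm[of "H X B"] hom_group[OF X B]
      hom_carrier[OF X B] j Comp_in[OF j ip] by (simp add: comm_group_def)
  then have "p \<cdot>\<^bsub>C\<^esub> (i \<cdot>\<^bsub>C\<^esub> (p \<cdot>\<^bsub>C\<^esub> j)) = \<one>\<^bsub>H X Y\<^esub>"
    using comp_one[OF X p] Comp_assoc[OF j p i] by simp
  then have pj: "p \<cdot>\<^bsub>C\<^esub> j = \<one>\<^bsub>H X Y\<^esub>"
    using Comp_assoc[OF Comp_in[OF j p] i p] pi Id_Comp[OF Comp_in[OF j p]] by simp
  note ia = Comp_in[OF a i] and jb = Comp_in[OF b j]
  define d where "d = (i \<cdot>\<^bsub>C\<^esub> a) \<otimes>\<^bsub>H P B\<^esub> inv\<^bsub>H P B\<^esub> (j \<cdot>\<^bsub>C\<^esub> b)"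
  have d: "d \<in> Hom C P B" unfolding d_def using add_in inv_in ia jb by blast
  have comp_d: "g \<cdot>\<^bsub>C\<^esub> d = ((g \<cdot>\<^bsub>C\<^esub> i) \<cdot>\<^bsub>C\<^esub> a) \<otimes>\<^bsub>H P W\<^esub> inv\<^bsub>H P W\<^esub> ((g \<cdot>\<^bsub>C\<^esub> j) \<cdot>\<^bsub>C\<^esub> b)"
    if "g \<in> Hom C B W" for g W
    unfolding d_def using comp_diff[OF ia jb that] Comp_assoc[OF a i that] Comp_assoc[OF b j that] by simp
  have pd: "p \<cdot>\<^bsub>C\<^esub> d = a"
  proof -
    have "p \<cdot>\<^bsub>C\<^esub> d = a \<otimes>\<^bsub>H P Y\<^esub> inv\<^bsub>H P Y\<^esub> \<one>\<^bsub>H P Y\<^esub>"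
      using comp_d[OF p] pi pj one_comp[OF Y b] Id_Comp[OF a] by simp
    moreover have "inv\<^bsub>H P Y\<^esub> \<one>\<^bsub>H P Y\<^esub> = \<one>\<^bsub>H P Y\<^esub>"
      using hom_group[OF P Y] by (simp add: comm_group_def group_def monoid.inv_one)
    ultimately show ?thesis using add_one[OF a] by simp
  qed
  obtain c where c: "is_cokernel C d c" by (rule cokernel_exists[OF d])
  define W where "W = Cod C c"
  have cB: "c \<in> Hom C B W" and cd: "zero_arr C (c \<cdot>\<^bsub>C\<^esub> d)"
    using is_cokernelD[OF c d] by (simp_all add: W_def)
  define m where "m = c \<cdot>\<^bsub>C\<^esub> i"
  define f where "f = c \<cdot>\<^bsub>C\<^esub> j"
  have m: "m \<in> Hom C Y W" and f: "f \<in> Hom C X W" unfolding m_def f_def using Comp_in i j cB by blast+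
  have ma: "m \<cdot>\<^bsub>C\<^esub> a = f \<cdot>\<^bsub>C\<^esub> b"
    using cd zero_arr_iff[OF Comp_in[OF d cB]] comp_d[OF cB] add_inv_eq_one_iff[OF Comp_in[OF a m] Comp_in[OF b f]]
    unfolding m_def f_def by simp
  have uniq: "\<exists>!u. u \<in> Hom C W T \<and> u \<cdot>\<^bsub>C\<^esub> m = x \<and> u \<cdot>\<^bsub>C\<^esub> f = y"
    if x: "x \<in> Hom C Y T" and y: "y \<in> Hom C X T" and xy: "x \<cdot>\<^bsub>C\<^esub> a = y \<cdot>\<^bsub>C\<^esub> b" for T x y
  proof -
    note T = Hom_Obj(2)[OF x]
    note xp = Comp_in[OF p x] and yq = Comp_in[OF q y]
    \<comment> \<open>The arrow out of the biproduct that restricts to \<open>x\<close> along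
      \<open>i\<close> and to \<open>y\<close> along \<open>j\<close>. It kills \<open>d\<close>
      exactly because \<open>xa = yb\<close>, so it descends to the cokernel.\<close>
    define h where "h = (x \<cdot>\<^bsub>C\<^esub> p) \<otimes>\<^bsub>H B T\<^esub> (y \<cdot>\<^bsub>C\<^esub> q)"
    have h: "h \<in> Hom C B T" unfolding h_def using add_in xp yq by blast
    have hi: "h \<cdot>\<^bsub>C\<^esub> i = x"
      unfolding h_def add_comp[OF i xp yq]
      using Comp_assoc[OF i p x] Comp_assoc[OF i q y] pi qi Comp_Id[OF x] comp_one[OF Y y] add_one[OF x] by simp
    have hj: "h \<cdot>\<^bsub>C\<^esub> j = y"
      unfolding h_def add_comp[OF j xp yq]
      using Comp_assoc[OF j p x] Comp_assoc[OF j q y] pj qj Comp_Id[OF y] comp_one[OF X x] add_one[OF y] by simp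
    have "h \<cdot>\<^bsub>C\<^esub> d = \<one>\<^bsub>H P T\<^esub>" using comp_d[OF h] hi hj xy add_inv[OF Comp_in[OF b y]] by simp
    then have "zero_arr C (h \<cdot>\<^bsub>C\<^esub> d)" using zero_arr_iff[OF Comp_in[OF d h]] by simp
    then obtain u where u: "u \<in> Hom C W T" "u \<cdot>\<^bsub>C\<^esub> c = h"
      using is_cokernel_factor[OF c d h] W_def by blast
    have "u \<cdot>\<^bsub>C\<^esub> m = x \<and> u \<cdot>\<^bsub>C\<^esub> f = y"
      unfolding m_def f_def using Comp_assoc[OF i cB u(1)] Comp_assoc[OF j cB u(1)] u(2) hi hj by simp
    moreover have "v = u" if v: "v \<in> Hom C W T" "v \<cdot>\<^bsub>C\<^esub> m = x" "v \<cdot>\<^bsub>C\<^esub> f = y" for v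
    proof -
      note vc = Comp_in[OF cB v(1)]
      have "v \<cdot>\<^bsub>C\<^esub> c = (v \<cdot>\<^bsub>C\<^esub> c) \<cdot>\<^bsub>C\<^esub> ((i \<cdot>\<^bsub>C\<^esub> p) \<otimes>\<^bsub>H B B\<^esub> (j \<cdot>\<^bsub>C\<^esub> q))" using sum Comp_Id[OF vc] by simp
      also have "\<dots> = h"
        unfolding comp_add[OF ip jq vc] h_def
        using Comp_assoc[OF p i vc] Comp_assoc[OF q j vc] Comp_assoc[OF i cB v(1)] Comp_assoc[OF j cB v(1)]
          v(2,3) by (simp add: m_def f_def)
      finally show ?thesis
        using epicD[OF is_cokernel_epic[OF c] cB v(1) u(1)] u(2) by simp
    qed
    ultimately show ?thesis using u(1) by blast
  qed
  have "is_pushout C a b m f"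
    unfolding is_pushout_def using Hom_D[OF a] Hom_D[OF b] Hom_D[OF m] Hom_D[OF f] ma uniq by simp
  moreover have "monic C f" if mon: "monic C a"
  proof (rule monic_if_cancels_zero[OF f])
    \<comment> \<open>From \<open>pd = a\<close> the difference \<open>d\<close> inherits monicity,
      so it is the kernel of its cokernel \<open>c\<close>. If \<open>fw = 0\<close>, then
      \<open>jw\<close> factors as \<open>du\<close>; applying \<open>p\<close> yields
      \<open>au = 0\<close>, hence \<open>u = 0\<close>, and applying \<open>q\<close> to
      \<open>jw = 0\<close> yields \<open>w = 0\<close>.\<close>
    have "monic C d"
      by (rule monicI[OF d]) (metis Comp_assoc[OF _ d p] pd monicD[OF mon a])
    then have k: "is_kernel C c d" using monic_is_kernel c by blast
    fix T w assume w: "w \<in> Hom C T X" "zero_arr C (f \<cdot>\<^bsub>C\<^esub> w)"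
    note jw = Comp_in[OF w(1) j]
    have "zero_arr C (c \<cdot>\<^bsub>C\<^esub> (j \<cdot>\<^bsub>C\<^esub> w))" using w(2) Comp_assoc[OF w(1) j cB] f_def by simp
    then obtain u where u: "u \<in> Hom C T P" "d \<cdot>\<^bsub>C\<^esub> u = j \<cdot>\<^bsub>C\<^esub> w"
      using is_kernel_factor[OF k cB jw] Hom_D(2)[OF d] by blast
    have "a \<cdot>\<^bsub>C\<^esub> u = p \<cdot>\<^bsub>C\<^esub> (j \<cdot>\<^bsub>C\<^esub> w)" using u Comp_assoc[OF u(1) d p] pd by simp
    also have "\<dots> = \<one>\<^bsub>H T Y\<^esub>" using Comp_assoc[OF w(1) j p] pj one_comp[OF Y w(1)] by simp
    finally have "zero_arr C u"
      using monic_cancels_zero[OF mon a u(1)] zero_arr_iff[OF Comp_in[OF u(1) a]] by simp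
    then have "zero_arr C (j \<cdot>\<^bsub>C\<^esub> w)" using zero_comp[OF _ u(1) d] u(2) by simp
    then have "zero_arr C (q \<cdot>\<^bsub>C\<^esub> (j \<cdot>\<^bsub>C\<^esub> w))" using zero_comp[OF _ jw q] by simp
    then show "zero_arr C w" using Comp_assoc[OF w(1) j q] qj Id_Comp[OF w(1)] by simp
  qed
  ultimately show thesis using that by blast
qed

text \<open>\<open>pushout_exists\<close> makes one particular pushout arrow \<open>f'\<close>
  monic. The comparison arrow satisfies \<open>uf = f'\<close>, which carries monicity to any other
  pushout.\<close>

lemma pushout_monic:
  assumes "is_pushout C a b m f" "a \<in> Hom C P Y" "b \<in> Hom C P X" "monic C a"
  shows "monic C f"
proof -
  obtain m' f' where m': "is_pushout C a b m' f'" "monic C f'"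
    using pushout_exists[OF assms(2,3)] assms(4) by metis
  note D = is_pushoutD[OF assms(1-3)] and D' = is_pushoutD[OF m'(1) assms(2,3)]
  obtain u where u: "u \<in> Hom C (Cod C m) (Cod C m')" "u \<cdot>\<^bsub>C\<^esub> f = f'"
    using is_pushout_factor[OF assms(1-3) D'] by blast
  show ?thesis
    by (rule monicI[OF D(2)]) (metis Comp_assoc[OF _ D(2) u(1)] u(2) monicD[OF m'(2) D'(2)])
qed

lemma kernel_zero_imp_monic:
  assumes "f \<in> Hom C X Y" "is_kernel C f k" "zero_arr C k"
  shows "monic C f"
  using preadditive_category.kernel_zero_imp_monic assms preadditive_exists by metis

end

subsection \<open>Functor categories\<close>

definition diagram :: "('o, 'm) cat \<Rightarrow> ('o \<Rightarrow> 'p) \<Rightarrow> ('m \<Rightarrow> 'q) \<Rightarrow> ('o, 'm, 'p, 'q) fctr" where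
  "diagram S X x = \<lparr>on_obj = restrict X (Obj S), on_arr = restrict x (Arr S)\<rparr>"

text \<open>Restricting the family gives the extensional form required by \<open>nat_transs\<close>,
  so any function that is correct on \<open>Obj S\<close> can be supplied.\<close>

definition transf :: "('o, 'm) cat \<Rightarrow> ('o, 'm, 'p, 'q) fctr \<Rightarrow> ('o, 'm, 'p, 'q) fctr \<Rightarrow>
    ('o \<Rightarrow> 'q) \<Rightarrow> ('o, 'm, 'p, 'q) nat_trans" where
  "transf S F G c = \<lparr>source = F, target = G, component = restrict c (Obj S)\<rparr>"

text \<open>A functor from \<open>S\<close> to \<open>A\<close> is literally a functor between the
  opposite categories, but a transformation between two such functors reverses direction. Thus
  \<open>flip\<close> realises the duality between \<open>Fun S A\<close> and
  \<open>Fun (opposite S) (opposite A)\<close> while leaving components untouched.\<close>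

definition flip :: "('o, 'm, 'p, 'q) nat_trans \<Rightarrow> ('o, 'm, 'p, 'q) nat_trans" where
  "flip t = \<lparr>source = target t, target = source t, component = component t\<rparr>"

lemma component_flip [simp]: "component (flip t) = component t"
  by (simp add: flip_def)

lemma component_transf [simp]: "s \<in> Obj S \<Longrightarrow> component (transf S F G c) s = c s"
  by (simp add: transf_def)

lemma component_Comp [simp]:
  "s \<in> Obj S \<Longrightarrow> component (t \<cdot>\<^bsub>Fun S A\<^esub> r) s = component t s \<cdot>\<^bsub>A\<^esub> component r s"
  by (simp add: Fun_def)

lemma component_Id [simp]: "s \<in> Obj S \<Longrightarrow> component (Id (Fun S A) F) s = Id A (on_obj F s)"
  by (simp add: Fun_def)

lemma Obj_Fun [simp]: "Obj (Fun S A) = functors S A"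
  by (simp add: Fun_def)

lemma Hom_Fun_iff:
  "t \<in> Hom (Fun S A) F G \<longleftrightarrow> t \<in> nat_transs S A \<and> source t = F \<and> target t = G"
  by (simp add: Hom_def Fun_def)

lemma Hom_FunD:
  assumes "t \<in> Hom (Fun S A) F G"
  shows "F \<in> functors S A" "G \<in> functors S A"
    and "s \<in> Obj S \<Longrightarrow> component t s \<in> Hom A (on_obj F s) (on_obj G s)"
    and "a \<in> Hom S r s \<Longrightarrow>
      component t s \<cdot>\<^bsub>A\<^esub> on_arr F a = on_arr G a \<cdot>\<^bsub>A\<^esub> component t r"
  using assms unfolding Hom_Fun_iff nat_transs_def by (auto simp: Hom_def)

text \<open>Components are extensional, so agreement on the indices is already equality of
  functions.\<close>

lemma Hom_Fun_eqI:
  assumes "t \<in> Hom (Fun S A) F G" "t' \<in> Hom (Fun S A) F G"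
    and "\<And>s. s \<in> Obj S \<Longrightarrow> component t s = component t' s"
  shows "t = t'"
proof -
  have "component t = component t'"
    using assms unfolding Hom_Fun_iff nat_transs_def by (auto intro: extensionalityI)
  then show ?thesis using assms(1,2) unfolding Hom_Fun_iff by (metis nat_trans.surjective old.unit.exhaust)
qed

lemma functorsD:
  assumes "F \<in> functors S A"
  shows "s \<in> Obj S \<Longrightarrow> on_obj F s \<in> Obj A"
    and "a \<in> Hom S r s \<Longrightarrow> on_arr F a \<in> Hom A (on_obj F r) (on_obj F s)"
    and "s \<in> Obj S \<Longrightarrow> on_arr F (Id S s) = Id A (on_obj F s)"
    and "a \<in> Hom S r s \<Longrightarrow> b \<in> Hom S s t \<Longrightarrow>
      on_arr F (b \<cdot>\<^bsub>S\<^esub> a) = on_arr F b \<cdot>\<^bsub>A\<^esub> on_arr F a"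
  using assms unfolding functors_def is_functor_def Hom_def by auto

lemma functors_opposite [simp]: "functors (opposite S) (opposite A) = functors S A"
  unfolding functors_def is_functor_def by auto

lemma flip_flip [simp]: "flip (flip t) = t"
  by (simp add: flip_def)

lemma flip_in: "t \<in> Hom (Fun S A) F G \<Longrightarrow> flip t \<in> Hom (Fun (opposite S) (opposite A)) G F"
  unfolding Hom_Fun_iff nat_transs_def by (auto simp: flip_def)

lemma flip_in': "t \<in> Hom (Fun (opposite S) (opposite A)) F G \<Longrightarrow> flip t \<in> Hom (Fun S A) G F"
  using flip_in[of t "opposite S" "opposite A"] by simp

section \<open>The category of functors and the constant diagram functor\<close>

locale index_category = S: category S + A: category A
  for S :: "('o, 'm) cat" and A :: "('p, 'q) cat"
begin

lemma opposite: "index_category (opposite S) (opposite A)"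
  using S.category_axioms A.category_axioms by (simp add: index_category_def category_opposite)

lemma diagramI:
  assumes "\<And>s. s \<in> Obj S \<Longrightarrow> X s \<in> Obj A"
    and "\<And>a r s. a \<in> Hom S r s \<Longrightarrow> x a \<in> Hom A (X r) (X s)"
    and "\<And>s. s \<in> Obj S \<Longrightarrow> x (Id S s) = Id A (X s)"
    and "\<And>a b r s t. a \<in> Hom S r s \<Longrightarrow> b \<in> Hom S s t \<Longrightarrow> x (b \<cdot>\<^bsub>S\<^esub> a) = x b \<cdot>\<^bsub>A\<^esub> x a"
  shows "diagram S X x \<in> functors S A"
proof -
  have "is_functor S A (diagram S X x)"
    unfolding is_functor_def
  proof (intro conjI ballI impI)
    fix f assume f: "f \<in> Arr S"
    show "on_arr (diagram S X x) f \<in>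
        Hom A (on_obj (diagram S X x) (Dom S f)) (on_obj (diagram S X x) (Cod S f))"
      using assms(2)[OF Arr_Hom[OF f]] f S.Dom_in S.Cod_in by (simp add: diagram_def)
    fix g assume g: "g \<in> Arr S" "Cod S f = Dom S g"
    have f': "f \<in> Hom S (Dom S f) (Dom S g)" using f g by (simp add: Hom_def)
    show "on_arr (diagram S X x) (g \<cdot>\<^bsub>S\<^esub> f) =
        on_arr (diagram S X x) g \<cdot>\<^bsub>A\<^esub> on_arr (diagram S X x) f"
      using assms(4)[OF f' Arr_Hom[OF g(1)]] S.Comp_in[OF f' Arr_Hom[OF g(1)]] f g
      by (simp add: diagram_def Hom_def)
  next
    fix s assume s: "s \<in> Obj S"
    show "on_obj (diagram S X x) s \<in> Obj A" using assms(1) s by (simp add: diagram_def)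
    show "on_arr (diagram S X x) (Id S s) = Id A (on_obj (diagram S X x) s)"
      using assms(3)[OF s] s Hom_D(1)[OF S.Id_in[OF s]] by (simp add: diagram_def)
  qed
  then show ?thesis by (simp add: functors_def diagram_def)
qed

lemma transfI:
  assumes "F \<in> functors S A" "G \<in> functors S A"
    and "\<And>s. s \<in> Obj S \<Longrightarrow> c s \<in> Hom A (on_obj F s) (on_obj G s)"
    and "\<And>a r s. a \<in> Hom S r s \<Longrightarrow> c s \<cdot>\<^bsub>A\<^esub> on_arr F a = on_arr G a \<cdot>\<^bsub>A\<^esub> c r"
  shows "transf S F G c \<in> Hom (Fun S A) F G"
  using assms(1-3) assms(4)[OF Arr_Hom] S.Dom_in S.Cod_in
  unfolding Hom_Fun_iff nat_transs_def by (simp add: transf_def)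

sublocale Fun: category "Fun S A"
proof
  fix f assume f: "f \<in> Arr (Fun S A)"
  then show "Dom (Fun S A) f \<in> Obj (Fun S A)" "Cod (Fun S A) f \<in> Obj (Fun S A)"
    by (simp_all add: Fun_def nat_transs_def)
next
  fix F assume "F \<in> Obj (Fun S A)"
  then have F: "F \<in> functors S A" by simp
  have "transf S F F (\<lambda>s. Id A (on_obj F s)) \<in> Hom (Fun S A) F F"
    using functorsD(1)[OF F] A.Id_in A.Comp_Id[OF functorsD(2)[OF F]]
      A.Id_Comp[OF functorsD(2)[OF F]] by (intro transfI F) simp_all
  then show "Id (Fun S A) F \<in> Hom (Fun S A) F F" by (simp add: transf_def Fun_def)
next
  fix f g F G K assume f: "f \<in> Hom (Fun S A) F G" and g: "g \<in> Hom (Fun S A) G K"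
  have "transf S F K (\<lambda>s. component g s \<cdot>\<^bsub>A\<^esub> component f s) \<in> Hom (Fun S A) F K"
  proof (rule transfI[OF Hom_FunD(1)[OF f] Hom_FunD(2)[OF g]])
    show "component g s \<cdot>\<^bsub>A\<^esub> component f s \<in> Hom A (on_obj F s) (on_obj K s)" if "s \<in> Obj S" for s
      using A.Comp_in Hom_FunD(3)[OF f that] Hom_FunD(3)[OF g that] by blast
    fix a r s assume a: "a \<in> Hom S r s"
    note s = S.Hom_Obj[OF a]
    note Fa = functorsD(2)[OF Hom_FunD(1)[OF f] a] and Ga = functorsD(2)[OF Hom_FunD(2)[OF f] a]
      and Ka = functorsD(2)[OF Hom_FunD(2)[OF g] a]
    show "(component g s \<cdot>\<^bsub>A\<^esub> component f s) \<cdot>\<^bsub>A\<^esub> on_arr F a =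
        on_arr K a \<cdot>\<^bsub>A\<^esub> component g r \<cdot>\<^bsub>A\<^esub> component f r"
      using A.Comp_assoc[OF Fa Hom_FunD(3)[OF f s(2)] Hom_FunD(3)[OF g s(2)]]
        A.Comp_assoc[OF Hom_FunD(3)[OF f s(1)] Ga Hom_FunD(3)[OF g s(2)]]
        A.Comp_assoc[OF Hom_FunD(3)[OF f s(1)] Hom_FunD(3)[OF g s(1)] Ka]
        Hom_FunD(4)[OF f a] Hom_FunD(4)[OF g a] by simp
  qed
  then show "g \<cdot>\<^bsub>Fun S A\<^esub> f \<in> Hom (Fun S A) F K"
    using f g by (simp add: transf_def Fun_def Hom_def)
  show "h \<cdot>\<^bsub>Fun S A\<^esub> (g \<cdot>\<^bsub>Fun S A\<^esub> f) = (h \<cdot>\<^bsub>Fun S A\<^esub> g) \<cdot>\<^bsub>Fun S A\<^esub> f"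
    if h: "h \<in> Hom (Fun S A) K M" for h M
    using A.Comp_assoc[OF Hom_FunD(3)[OF f] Hom_FunD(3)[OF g] Hom_FunD(3)[OF h]]
    by (simp add: Fun_def cong: restrict_cong)
next
  fix f F G assume f: "f \<in> Hom (Fun S A) F G"
  \<comment> \<open>Composition in \<open>Fun S A\<close> restricts the family of components; the
    identity laws therefore rely on \<open>component f\<close> being restricted already.\<close>
  have "component f \<in> extensional (Obj S)" using f unfolding Hom_Fun_iff nat_transs_def by simp
  then have "restrict (component f) (Obj S) = component f" by (simp add: extensional_restrict)
  moreover have "f = \<lparr>source = F, target = G, component = component f\<rparr>"
    using f by (simp add: Hom_Fun_iff)
  ultimately show "f \<cdot>\<^bsub>Fun S A\<^esub> Id (Fun S A) F = f" "Id (Fun S A) G \<cdot>\<^bsub>Fun S A\<^esub> f = f"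
    using A.Comp_Id[OF Hom_FunD(3)[OF f]] A.Id_Comp[OF Hom_FunD(3)[OF f]] f
    by (simp_all add: Fun_def Hom_Fun_iff[unfolded Fun_def] cong: restrict_cong)
qed

lemma pointwise_monic:
  assumes t: "t \<in> Hom (Fun S A) F G" and m: "\<And>s. s \<in> Obj S \<Longrightarrow> monic A (component t s)"
  shows "monic (Fun S A) t"
proof (rule monicI[OF t])
  fix W g h assume gh: "g \<in> Hom (Fun S A) W F" "h \<in> Hom (Fun S A) W F"
    "t \<cdot>\<^bsub>Fun S A\<^esub> g = t \<cdot>\<^bsub>Fun S A\<^esub> h"
  show "g = h"
  proof (rule Hom_Fun_eqI[OF gh(1,2)])
    fix s assume s: "s \<in> Obj S"
    have "component t s \<cdot>\<^bsub>A\<^esub> component g s = component t s \<cdot>\<^bsub>A\<^esub> component h s"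
      using gh(3) component_Comp[OF s] by metis
    then show "component g s = component h s"
      using monicD[OF m[OF s] Hom_FunD(3)[OF t s]] Hom_FunD(3)[OF gh(1) s] Hom_FunD(3)[OF gh(2) s]
      by blast
  qed
qed

lemma pointwise_epic:
  assumes t: "t \<in> Hom (Fun S A) F G" and m: "\<And>s. s \<in> Obj S \<Longrightarrow> epic A (component t s)"
  shows "epic (Fun S A) t"
proof (rule epicI[OF t])
  fix W g h assume gh: "g \<in> Hom (Fun S A) G W" "h \<in> Hom (Fun S A) G W"
    "g \<cdot>\<^bsub>Fun S A\<^esub> t = h \<cdot>\<^bsub>Fun S A\<^esub> t"
  show "g = h"
  proof (rule Hom_Fun_eqI[OF gh(1,2)])
    fix s assume s: "s \<in> Obj S"
    have "component g s \<cdot>\<^bsub>A\<^esub> component t s = component h s \<cdot>\<^bsub>A\<^esub> component t s"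
      using gh(3) component_Comp[OF s] by metis
    then show "component g s = component h s"
      using epicD[OF m[OF s] Hom_FunD(3)[OF t s]] Hom_FunD(3)[OF gh(1) s] Hom_FunD(3)[OF gh(2) s]
      by blast
  qed
qed

text \<open>Factors are chosen separately at each index, yet they are automatically natural: both
  sides of the naturality equation agree after composition with the monic
  \<open>component k s\<close>.\<close>

lemma factor_through_monic:
  assumes k: "k \<in> Hom (Fun S A) K F" and h: "h \<in> Hom (Fun S A) W F"
    and m: "\<And>s. s \<in> Obj S \<Longrightarrow> monic A (component k s)"
    and ex: "\<And>s. s \<in> Obj S \<Longrightarrow>
      \<exists>u \<in> Hom A (on_obj W s) (on_obj K s). component k s \<cdot>\<^bsub>A\<^esub> u = component h s"
  shows "\<exists>u \<in> Hom (Fun S A) W K. k \<cdot>\<^bsub>Fun S A\<^esub> u = h"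
proof -
  obtain u where u: "\<And>s. s \<in> Obj S \<Longrightarrow> u s \<in> Hom A (on_obj W s) (on_obj K s)"
    "\<And>s. s \<in> Obj S \<Longrightarrow> component k s \<cdot>\<^bsub>A\<^esub> u s = component h s"
    using ex by metis
  have U: "transf S W K u \<in> Hom (Fun S A) W K"
  proof (rule transfI[OF Hom_FunD(1)[OF h] Hom_FunD(1)[OF k] u(1)])
    fix a r s assume a: "a \<in> Hom S r s"
    note s = S.Hom_Obj[OF a]
    note Wa = functorsD(2)[OF Hom_FunD(1)[OF h] a] and Ka = functorsD(2)[OF Hom_FunD(1)[OF k] a]
      and Fa = functorsD(2)[OF Hom_FunD(2)[OF k] a]
    note ks = Hom_FunD(3)[OF k s(2)] and kr = Hom_FunD(3)[OF k s(1)]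
    have "component k s \<cdot>\<^bsub>A\<^esub> (u s \<cdot>\<^bsub>A\<^esub> on_arr W a) = on_arr F a \<cdot>\<^bsub>A\<^esub> component h r"
      using A.Comp_assoc[OF Wa u(1)[OF s(2)] ks] u(2)[OF s(2)] Hom_FunD(4)[OF h a] by simp
    also have "\<dots> = component k s \<cdot>\<^bsub>A\<^esub> (on_arr K a \<cdot>\<^bsub>A\<^esub> u r)"
      using A.Comp_assoc[OF u(1)[OF s(1)] kr Fa] A.Comp_assoc[OF u(1)[OF s(1)] Ka ks]
        u(2)[OF s(1)] Hom_FunD(4)[OF k a] by simp
    finally show "u s \<cdot>\<^bsub>A\<^esub> on_arr W a = on_arr K a \<cdot>\<^bsub>A\<^esub> u r"
      using monicD[OF m[OF s(2)] ks A.Comp_in[OF Wa u(1)[OF s(2)]] A.Comp_in[OF u(1)[OF s(1)] Ka]] by blast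
  qed
  have "k \<cdot>\<^bsub>Fun S A\<^esub> transf S W K u = h"
    by (rule Hom_Fun_eqI[OF Fun.Comp_in[OF U k] h]) (simp add: u(2))
  then show ?thesis using U by blast
qed

text \<open>The dual of \<open>factor_through_monic\<close>, transported by
  \<open>flip\<close>.\<close>

lemma factor_through_epic:
  assumes c: "c \<in> Hom (Fun S A) F K" and h: "h \<in> Hom (Fun S A) F W"
    and e: "\<And>s. s \<in> Obj S \<Longrightarrow> epic A (component c s)"
    and ex: "\<And>s. s \<in> Obj S \<Longrightarrow>
      \<exists>u \<in> Hom A (on_obj K s) (on_obj W s). u \<cdot>\<^bsub>A\<^esub> component c s = component h s"
  shows "\<exists>u \<in> Hom (Fun S A) K W. u \<cdot>\<^bsub>Fun S A\<^esub> c = h"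
proof -
  have "\<exists>u \<in> Hom (Fun (opposite S) (opposite A)) W K.
      flip c \<cdot>\<^bsub>Fun (opposite S) (opposite A)\<^esub> u = flip h"
    by (rule index_category.factor_through_monic[OF opposite flip_in[OF c] flip_in[OF h]])
      (use e ex in auto)
  then obtain u where u: "u \<in> Hom (Fun (opposite S) (opposite A)) W K"
    "flip c \<cdot>\<^bsub>Fun (opposite S) (opposite A)\<^esub> u = flip h" by blast
  have "flip u \<cdot>\<^bsub>Fun S A\<^esub> c = h"
  proof (rule Hom_Fun_eqI[OF Fun.Comp_in[OF c flip_in'[OF u(1)]] h])
    fix s assume s: "s \<in> Obj S"
    have "component (flip c \<cdot>\<^bsub>Fun (opposite S) (opposite A)\<^esub> u) s = component h s"
      using u(2) by simp
    then show "component (flip u \<cdot>\<^bsub>Fun S A\<^esub> c) s = component h s" using s by simp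
  qed
  then show ?thesis using flip_in'[OF u(1)] by blast
qed

lemma const_diag_obj: "on_obj (const_diag S A) X = diagram S (\<lambda>s. X) (\<lambda>a. Id A X)"
  by (simp add: const_diag_def diagram_def)

lemma const_diag_arr:
  "f \<in> Hom A X Y \<Longrightarrow>
    on_arr (const_diag S A) f =
      transf S (on_obj (const_diag S A) X) (on_obj (const_diag S A) Y) (\<lambda>s. f)"
  by (simp add: const_diag_def transf_def Hom_def)

lemma on_obj_const_diag [simp]: "s \<in> Obj S \<Longrightarrow> on_obj (on_obj (const_diag S A) X) s = X"
  by (simp add: const_diag_obj diagram_def)

lemma component_const_diag [simp]: "s \<in> Obj S \<Longrightarrow> component (on_arr (const_diag S A) f) s = f"
  by (simp add: const_diag_def Let_def)

lemma const_diag_obj_in: "X \<in> Obj A \<Longrightarrow> on_obj (const_diag S A) X \<in> functors S A"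
  unfolding const_diag_obj using A.Id_in A.Id_Comp by (intro diagramI) metis+

lemma const_diag_arr_in:
  assumes "f \<in> Hom A X Y"
  shows "on_arr (const_diag S A) f \<in>
    Hom (Fun S A) (on_obj (const_diag S A) X) (on_obj (const_diag S A) Y)"
  unfolding const_diag_arr[OF assms]
proof (rule transfI)
  fix a r s assume "a \<in> Hom S r s"
  then show "f \<cdot>\<^bsub>A\<^esub> on_arr (on_obj (const_diag S A) X) a =
      on_arr (on_obj (const_diag S A) Y) a \<cdot>\<^bsub>A\<^esub> f"
    using A.Comp_Id[OF assms] A.Id_Comp[OF assms] by (simp add: const_diag_obj diagram_def Hom_def)
qed (use A.Hom_Obj[OF assms] const_diag_obj_in assms in auto)

lemma const_diag_comp:
  assumes "f \<in> Hom A X Y" "g \<in> Hom A Y Z"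
  shows "on_arr (const_diag S A) (g \<cdot>\<^bsub>A\<^esub> f) =
    on_arr (const_diag S A) g \<cdot>\<^bsub>Fun S A\<^esub> on_arr (const_diag S A) f"
  by (rule Hom_Fun_eqI[OF const_diag_arr_in[OF A.Comp_in[OF assms]]
        Fun.Comp_in[OF const_diag_arr_in[OF assms(1)] const_diag_arr_in[OF assms(2)]]]) simp

lemma const_diag_Id:
  assumes "X \<in> Obj A"
  shows "on_arr (const_diag S A) (Id A X) = Id (Fun S A) (on_obj (const_diag S A) X)"
  by (rule Hom_Fun_eqI[OF const_diag_arr_in[OF A.Id_in[OF assms]] Fun.Id_in])
    (simp_all add: const_diag_obj_in assms)

end

section \<open>Objectwise kernels, cokernels and pushouts of diagrams in an abelian category\<close>

locale abelian_diagrams = index_category S A + A: abelian A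
  for S :: "('o, 'm) cat" and A :: "('p, 'q) cat"
begin

lemma opposite_diagrams: "abelian_diagrams (opposite S) (opposite A)"
  unfolding abelian_diagrams_def using opposite A.opposite_abelian by (simp add: abelian_def)

text \<open>Naturality is free: any two parallel arrows into, or out of, the zero object
  \<open>Z\<close> coincide.\<close>

lemma zero_obj_const_diag:
  assumes Z: "zero_obj A Z"
  shows "zero_obj (Fun S A) (on_obj (const_diag S A) Z)" (is "zero_obj _ ?Z")
proof -
  have Z': "?Z \<in> functors S A" using const_diag_obj_in zero_obj_Obj[OF Z] .
  note uniq = zero_obj_arrow_unique[OF Z] and ex = zero_obj_arrow_exists[OF Z]
  have "(\<exists>!f. f \<in> Hom (Fun S A) F ?Z) \<and> (\<exists>!f. f \<in> Hom (Fun S A) ?Z F)" if F: "F \<in> functors S A" for F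
  proof
    obtain u where u: "\<And>s. s \<in> Obj S \<Longrightarrow> u s \<in> Hom A (on_obj F s) Z"
      using ex(1)[OF functorsD(1)[OF F]] by metis
    obtain v where v: "\<And>s. s \<in> Obj S \<Longrightarrow> v s \<in> Hom A Z (on_obj F s)"
      using ex(2)[OF functorsD(1)[OF F]] by metis
    have nat: "u s \<cdot>\<^bsub>A\<^esub> on_arr F a = on_arr ?Z a \<cdot>\<^bsub>A\<^esub> u r"
      "v s \<cdot>\<^bsub>A\<^esub> on_arr ?Z a = on_arr F a \<cdot>\<^bsub>A\<^esub> v r" if a: "a \<in> Hom S r s" for a r s
    proof -
      note s = S.Hom_Obj[OF a]
      have Za: "on_arr ?Z a \<in> Hom A Z Z" using functorsD(2)[OF Z' a] s by simp
      show "u s \<cdot>\<^bsub>A\<^esub> on_arr F a = on_arr ?Z a \<cdot>\<^bsub>A\<^esub> u r"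
        using uniq(1)[OF functorsD(1)[OF F s(1)] A.Comp_in[OF functorsD(2)[OF F a] u[OF s(2)]]
            A.Comp_in[OF u[OF s(1)] Za]] .
      show "v s \<cdot>\<^bsub>A\<^esub> on_arr ?Z a = on_arr F a \<cdot>\<^bsub>A\<^esub> v r"
        using uniq(2)[OF functorsD(1)[OF F s(2)] A.Comp_in[OF Za v[OF s(2)]]
            A.Comp_in[OF v[OF s(1)] functorsD(2)[OF F a]]] .
    qed
    have "transf S F ?Z u \<in> Hom (Fun S A) F ?Z" using u nat by (intro transfI F Z') simp_all
    moreover have "f = g" if "f \<in> Hom (Fun S A) F ?Z" "g \<in> Hom (Fun S A) F ?Z" for f g
      using uniq(1)[OF functorsD(1)[OF F]] Hom_FunD(3)[OF that(1)] Hom_FunD(3)[OF that(2)]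
      by (intro Hom_Fun_eqI[OF that]) auto
    ultimately show "\<exists>!f. f \<in> Hom (Fun S A) F ?Z" by blast
    have "transf S ?Z F v \<in> Hom (Fun S A) ?Z F" using v nat by (intro transfI F Z') simp_all
    moreover have "f = g" if "f \<in> Hom (Fun S A) ?Z F" "g \<in> Hom (Fun S A) ?Z F" for f g
      using uniq(2)[OF functorsD(1)[OF F]] Hom_FunD(3)[OF that(1)] Hom_FunD(3)[OF that(2)]
      by (intro Hom_Fun_eqI[OF that]) auto
    ultimately show "\<exists>!f. f \<in> Hom (Fun S A) ?Z F" by blast
  qed
  then show ?thesis unfolding zero_obj_def using Z' by simp
qed

text \<open>The composite \<open>vu\<close> through a constant zero diagram is zero both as a
  transformation and at every index. Uniqueness of zero arrows in \<open>Fun S A\<close> and in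
  \<open>A\<close> identifies \<open>t\<close> with it in either direction.\<close>

lemma zero_arr_Fun_iff:
  assumes t: "t \<in> Hom (Fun S A) F G"
  shows "zero_arr (Fun S A) t \<longleftrightarrow> (\<forall>s \<in> Obj S. zero_arr A (component t s))"
proof -
  obtain Z where Z: "zero_obj A Z" using A.zero_obj_exists by blast
  note Z' = zero_obj_const_diag[OF Z]
  obtain u v where u: "u \<in> Hom (Fun S A) F (on_obj (const_diag S A) Z)"
    and v: "v \<in> Hom (Fun S A) (on_obj (const_diag S A) Z) G"
    using zero_obj_arrow_exists[OF Z', unfolded Obj_Fun] Hom_FunD(1,2)[OF t] by blast
  have vu: "v \<cdot>\<^bsub>Fun S A\<^esub> u \<in> Hom (Fun S A) F G" using Fun.Comp_in[OF u v] .
  have z: "zero_arr (Fun S A) (v \<cdot>\<^bsub>Fun S A\<^esub> u)" using Fun.zero_arrI[OF Z' u v] .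
  have p: "zero_arr A (component (v \<cdot>\<^bsub>Fun S A\<^esub> u) s)" if s: "s \<in> Obj S" for s
    using A.zero_arrI[OF Z] Hom_FunD(3)[OF u s] Hom_FunD(3)[OF v s] s by simp
  show ?thesis
  proof
    assume "zero_arr (Fun S A) t"
    then have "t = v \<cdot>\<^bsub>Fun S A\<^esub> u" using Fun.zero_arr_unique[OF _ t z vu] by blast
    then show "\<forall>s \<in> Obj S. zero_arr A (component t s)" using p by blast
  next
    assume *: "\<forall>s \<in> Obj S. zero_arr A (component t s)"
    have "t = v \<cdot>\<^bsub>Fun S A\<^esub> u"
      using * A.zero_arr_unique[OF _ Hom_FunD(3)[OF t] p Hom_FunD(3)[OF vu]]
      by (intro Hom_Fun_eqI[OF t vu]) blast
    then show "zero_arr (Fun S A) t" using z by simp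
  qed
qed

lemma pointwise_kernel:
  assumes t: "t \<in> Hom (Fun S A) F G" and k: "k \<in> Hom (Fun S A) K F"
    and ker: "\<And>s. s \<in> Obj S \<Longrightarrow> is_kernel A (component t s) (component k s)"
  shows "is_kernel (Fun S A) t k"
proof (rule is_kernelI[OF t k])
  note mon = A.is_kernel_monic[OF ker]
  show "zero_arr (Fun S A) (t \<cdot>\<^bsub>Fun S A\<^esub> k)"
    using is_kernelD(2)[OF ker Hom_FunD(3)[OF t]] zero_arr_Fun_iff[OF Fun.Comp_in[OF k t]] by simp
  show "monic (Fun S A) k" using pointwise_monic[OF k mon] .
  fix W h assume h: "h \<in> Hom (Fun S A) W F" "zero_arr (Fun S A) (t \<cdot>\<^bsub>Fun S A\<^esub> h)"
  show "\<exists>u\<in>Hom (Fun S A) W K. k \<cdot>\<^bsub>Fun S A\<^esub> u = h"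
  proof (rule factor_through_monic[OF k h(1) mon])
    fix s assume s: "s \<in> Obj S"
    have "zero_arr A (component t s \<cdot>\<^bsub>A\<^esub> component h s)"
      using h(2) zero_arr_Fun_iff[OF Fun.Comp_in[OF h(1) t]] s by simp
    then show "\<exists>u\<in>Hom A (on_obj W s) (on_obj K s). component k s \<cdot>\<^bsub>A\<^esub> u = component h s"
      using is_kernel_factor[OF ker[OF s] Hom_FunD(3)[OF t s] Hom_FunD(3)[OF h(1) s]]
        Hom_D(2)[OF Hom_FunD(3)[OF k s]] by metis
  qed
qed

lemma pointwise_cokernel:
  assumes t: "t \<in> Hom (Fun S A) F G" and c: "c \<in> Hom (Fun S A) G K"
    and cok: "\<And>s. s \<in> Obj S \<Longrightarrow> is_cokernel A (component t s) (component c s)"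
  shows "is_cokernel (Fun S A) t c"
proof (rule is_cokernelI[OF t c])
  note epi = A.is_cokernel_epic[OF cok]
  show "zero_arr (Fun S A) (c \<cdot>\<^bsub>Fun S A\<^esub> t)"
    using is_cokernelD(2)[OF cok Hom_FunD(3)[OF t]] zero_arr_Fun_iff[OF Fun.Comp_in[OF t c]] by simp
  show "epic (Fun S A) c" using pointwise_epic[OF c epi] .
  fix W h assume h: "h \<in> Hom (Fun S A) G W" "zero_arr (Fun S A) (h \<cdot>\<^bsub>Fun S A\<^esub> t)"
  show "\<exists>u\<in>Hom (Fun S A) K W. u \<cdot>\<^bsub>Fun S A\<^esub> c = h"
  proof (rule factor_through_epic[OF c h(1) epi])
    fix s assume s: "s \<in> Obj S"
    have "zero_arr A (component h s \<cdot>\<^bsub>A\<^esub> component t s)"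
      using h(2) zero_arr_Fun_iff[OF Fun.Comp_in[OF t h(1)]] s by simp
    then show "\<exists>u\<in>Hom A (on_obj K s) (on_obj W s). u \<cdot>\<^bsub>A\<^esub> component c s = component h s"
      using is_cokernel_factor[OF cok[OF s] Hom_FunD(3)[OF t s] Hom_FunD(3)[OF h(1) s]]
        Hom_D(3)[OF Hom_FunD(3)[OF c s]] by metis
  qed
qed

text \<open>Pushouts are chosen independently at each index. Their universal properties induce the
  transition arrows, and joint epicness forces these arrows to respect identities and composition.
  Cokernels and, dually, kernels of transformations are derived from this one construction.\<close>

lemma pointwise_pushout_exists:
  assumes t: "t \<in> Hom (Fun S A) F G" and b: "b \<in> Hom (Fun S A) F K"
  obtains P m f where "m \<in> Hom (Fun S A) G P" "f \<in> Hom (Fun S A) K P"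
    and "\<And>s. s \<in> Obj S \<Longrightarrow>
      is_pushout A (component t s) (component b s) (component m s) (component f s)"
proof -
  note F = Hom_FunD(1)[OF t] and G = Hom_FunD(2)[OF t] and K = Hom_FunD(2)[OF b]
  note ts = Hom_FunD(3)[OF t] and bs = Hom_FunD(3)[OF b]
  have "\<exists>m f. is_pushout A (component t s) (component b s) m f" if "s \<in> Obj S" for s
    using A.pushout_exists[OF ts[OF that] bs[OF that]] by blast
  then obtain m f where po: "\<And>s. s \<in> Obj S \<Longrightarrow>
      is_pushout A (component t s) (component b s) (m s) (f s)"
    by metis
  define P where "P s = Cod A (m s)" for s
  have m: "m s \<in> Hom A (on_obj G s) (P s)" and f: "f s \<in> Hom A (on_obj K s) (P s)"
    and mf: "m s \<cdot>\<^bsub>A\<^esub> component t s = f s \<cdot>\<^bsub>A\<^esub> component b s" if "s \<in> Obj S" for s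
    using is_pushoutD[OF po ts bs] that by (simp_all add: P_def)
  have uniq: "u = v" if "s \<in> Obj S" "u \<in> Hom A (P s) W" "v \<in> Hom A (P s) W"
    "u \<cdot>\<^bsub>A\<^esub> m s = v \<cdot>\<^bsub>A\<^esub> m s" "u \<cdot>\<^bsub>A\<^esub> f s = v \<cdot>\<^bsub>A\<^esub> f s" for u v s W
    using A.pushout_jointly_epic[OF po ts bs] that by (simp add: P_def)
  have "\<exists>u. u \<in> Hom A (P (Dom S a)) (P (Cod S a)) \<and>
      u \<cdot>\<^bsub>A\<^esub> m (Dom S a) = m (Cod S a) \<cdot>\<^bsub>A\<^esub> on_arr G a \<and>
      u \<cdot>\<^bsub>A\<^esub> f (Dom S a) = f (Cod S a) \<cdot>\<^bsub>A\<^esub> on_arr K a" if "a \<in> Arr S" for a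
  proof -
    define r s where "r = Dom S a" and "s = Cod S a"
    have a: "a \<in> Hom S r s" using that by (simp add: r_def s_def Hom_def)
    note rs = S.Hom_Obj[OF a]
    note Fa = functorsD(2)[OF F a] and Ga = functorsD(2)[OF G a] and Ka = functorsD(2)[OF K a]
    \<comment> \<open>Naturality of \<open>t\<close> and \<open>b\<close> shows that the cocone at
      \<open>s\<close>, pulled back along \<open>a\<close>, is compatible with the span at
      \<open>r\<close>; it thus induces the transition arrow.\<close>
    have "(m s \<cdot>\<^bsub>A\<^esub> on_arr G a) \<cdot>\<^bsub>A\<^esub> component t r = m s \<cdot>\<^bsub>A\<^esub> (component t s \<cdot>\<^bsub>A\<^esub> on_arr F a)"
      using A.Comp_assoc[OF ts[OF rs(1)] Ga m[OF rs(2)]] Hom_FunD(4)[OF t a] by simp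
    also have "\<dots> = f s \<cdot>\<^bsub>A\<^esub> (component b s \<cdot>\<^bsub>A\<^esub> on_arr F a)"
      using A.Comp_assoc[OF Fa ts[OF rs(2)] m[OF rs(2)]] A.Comp_assoc[OF Fa bs[OF rs(2)] f[OF rs(2)]]
        mf[OF rs(2)] by simp
    also have "\<dots> = (f s \<cdot>\<^bsub>A\<^esub> on_arr K a) \<cdot>\<^bsub>A\<^esub> component b r"
      using A.Comp_assoc[OF bs[OF rs(1)] Ka f[OF rs(2)]] Hom_FunD(4)[OF b a] by simp
    finally show ?thesis
      using is_pushout_factor[OF po[OF rs(1)] ts[OF rs(1)] bs[OF rs(1)]
          A.Comp_in[OF Ga m[OF rs(2)]] A.Comp_in[OF Ka f[OF rs(2)]]]
      unfolding r_def s_def P_def by blast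
  qed
  then obtain p where p0: "\<And>a. a \<in> Arr S \<Longrightarrow> p a \<in> Hom A (P (Dom S a)) (P (Cod S a)) \<and>
      p a \<cdot>\<^bsub>A\<^esub> m (Dom S a) = m (Cod S a) \<cdot>\<^bsub>A\<^esub> on_arr G a \<and>
      p a \<cdot>\<^bsub>A\<^esub> f (Dom S a) = f (Cod S a) \<cdot>\<^bsub>A\<^esub> on_arr K a"
    by metis
  have p: "p a \<in> Hom A (P r) (P s)" and pm: "p a \<cdot>\<^bsub>A\<^esub> m r = m s \<cdot>\<^bsub>A\<^esub> on_arr G a"
    and pf: "p a \<cdot>\<^bsub>A\<^esub> f r = f s \<cdot>\<^bsub>A\<^esub> on_arr K a" if "a \<in> Hom S r s" for a r s
    using p0[OF Hom_D(1)[OF that]] Hom_D[OF that] by auto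
  have D: "diagram S P p \<in> functors S A"
  proof (rule diagramI)
    show "P s \<in> Obj A" if "s \<in> Obj S" for s using A.Hom_Obj(2)[OF m[OF that]] .
    show "p a \<in> Hom A (P r) (P s)" if "a \<in> Hom S r s" for a r s using p[OF that] .
    show "p (Id S s) = Id A (P s)" if s: "s \<in> Obj S" for s
    proof (rule uniq[OF s p[OF S.Id_in[OF s]] A.Id_in[OF A.Hom_Obj(2)[OF m[OF s]]]])
      show "p (Id S s) \<cdot>\<^bsub>A\<^esub> m s = Id A (P s) \<cdot>\<^bsub>A\<^esub> m s"
        using pm[OF S.Id_in[OF s]] A.Comp_Id[OF m[OF s]] A.Id_Comp[OF m[OF s]] functorsD(3)[OF G s]
        by simp
      show "p (Id S s) \<cdot>\<^bsub>A\<^esub> f s = Id A (P s) \<cdot>\<^bsub>A\<^esub> f s"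
        using pf[OF S.Id_in[OF s]] A.Comp_Id[OF f[OF s]] A.Id_Comp[OF f[OF s]] functorsD(3)[OF K s]
        by simp
    qed
    fix a c q r s assume a: "a \<in> Hom S q r" and c: "c \<in> Hom S r s"
    note q = S.Hom_Obj[OF a] and s = S.Hom_Obj[OF c]
    have ca: "c \<cdot>\<^bsub>S\<^esub> a \<in> Hom S q s" using S.Comp_in[OF a c] .
    show "p (c \<cdot>\<^bsub>S\<^esub> a) = p c \<cdot>\<^bsub>A\<^esub> p a"
    proof (rule uniq[OF q(1) p[OF ca] A.Comp_in[OF p[OF a] p[OF c]]])
      show "p (c \<cdot>\<^bsub>S\<^esub> a) \<cdot>\<^bsub>A\<^esub> m q = (p c \<cdot>\<^bsub>A\<^esub> p a) \<cdot>\<^bsub>A\<^esub> m q"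
        using pm[OF ca] functorsD(4)[OF G a c] A.Comp_assoc[OF m[OF q(1)] p[OF a] p[OF c]] pm[OF a]
          A.Comp_assoc[OF functorsD(2)[OF G a] m[OF q(2)] p[OF c]] pm[OF c]
          A.Comp_assoc[OF functorsD(2)[OF G a] functorsD(2)[OF G c] m[OF s(2)]] by simp
      show "p (c \<cdot>\<^bsub>S\<^esub> a) \<cdot>\<^bsub>A\<^esub> f q = (p c \<cdot>\<^bsub>A\<^esub> p a) \<cdot>\<^bsub>A\<^esub> f q"
        using pf[OF ca] functorsD(4)[OF K a c] A.Comp_assoc[OF f[OF q(1)] p[OF a] p[OF c]] pf[OF a]
          A.Comp_assoc[OF functorsD(2)[OF K a] f[OF q(2)] p[OF c]] pf[OF c]
          A.Comp_assoc[OF functorsD(2)[OF K a] functorsD(2)[OF K c] f[OF s(2)]] by simp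
    qed
  qed
  have [simp]: "on_obj (diagram S P p) s = P s" if "s \<in> Obj S" for s
    using that by (simp add: diagram_def)
  have [simp]: "on_arr (diagram S P p) a = p a" if "a \<in> Hom S r s" for a r s
    using Hom_D(1)[OF that] by (simp add: diagram_def)
  have "transf S G (diagram S P p) m \<in> Hom (Fun S A) G (diagram S P p)"
    by (rule transfI[OF G D]) (simp_all add: m pm)
  moreover have "transf S K (diagram S P p) f \<in> Hom (Fun S A) K (diagram S P p)"
    by (rule transfI[OF K D]) (simp_all add: f pf)
  ultimately show thesis using that po by simp
qed

text \<open>A cokernel is the pushout along the arrow to a zero object. Taking \<open>b\<close> to
  be the transformation to the constant zero diagram avoids a second construction of transition
  arrows.\<close>

lemma pointwise_cokernel_exists:
  assumes t: "t \<in> Hom (Fun S A) F G"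
  obtains K c where "c \<in> Hom (Fun S A) G K"
    and "\<And>s. s \<in> Obj S \<Longrightarrow> is_cokernel A (component t s) (component c s)"
proof -
  obtain Z where Z: "zero_obj A Z" using A.zero_obj_exists by blast
  let ?Z = "on_obj (const_diag S A) Z"
  obtain b where b: "b \<in> Hom (Fun S A) F ?Z"
    using zero_obj_arrow_exists[OF zero_obj_const_diag[OF Z], unfolded Obj_Fun] Hom_FunD(1)[OF t]
    by blast
  obtain P m f where m: "m \<in> Hom (Fun S A) G P" and f: "f \<in> Hom (Fun S A) ?Z P"
    and po: "\<And>s. s \<in> Obj S \<Longrightarrow>
      is_pushout A (component t s) (component b s) (component m s) (component f s)"
    using pointwise_pushout_exists[OF t b] by metis
  have "is_cokernel A (component t s) (component m s)" if s: "s \<in> Obj S" for s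
  proof (rule is_cokernelI[OF Hom_FunD(3)[OF t s] Hom_FunD(3)[OF m s]])
    note ts = Hom_FunD(3)[OF t s] and ms = Hom_FunD(3)[OF m s]
    have bs: "component b s \<in> Hom A (on_obj F s) Z" and fs: "component f s \<in> Hom A Z (on_obj P s)"
      using Hom_FunD(3)[OF b s] Hom_FunD(3)[OF f s] s by simp_all
    have cod: "Cod A (component m s) = on_obj P s" using Hom_D(3)[OF ms] .
    show "zero_arr A (component m s \<cdot>\<^bsub>A\<^esub> component t s)"
      using is_pushoutD(3)[OF po[OF s] ts bs] A.zero_arrI[OF Z bs fs] by simp
    show "epic A (component m s)"
    proof (rule epicI[OF ms])
      fix W g h assume gh: "g \<in> Hom A (on_obj P s) W" "h \<in> Hom A (on_obj P s) W"
        "g \<cdot>\<^bsub>A\<^esub> component m s = h \<cdot>\<^bsub>A\<^esub> component m s"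
      \<comment> \<open>This leg of the pushout starts at a zero object, so agreement on it is
        automatic.\<close>
      have "g \<cdot>\<^bsub>A\<^esub> component f s = h \<cdot>\<^bsub>A\<^esub> component f s"
        using zero_obj_arrow_unique(2)[OF Z A.Hom_Obj(2)[OF gh(1)]] A.Comp_in[OF fs] gh by blast
      then show "g = h"
        using A.pushout_jointly_epic[OF po[OF s] ts bs] gh cod by simp
    qed
    fix W h assume h: "h \<in> Hom A (on_obj G s) W" "zero_arr A (h \<cdot>\<^bsub>A\<^esub> component t s)"
    obtain y where y: "y \<in> Hom A Z W"
      using zero_obj_arrow_exists(2)[OF Z A.Hom_Obj(2)[OF h(1)]] by blast
    have "h \<cdot>\<^bsub>A\<^esub> component t s = y \<cdot>\<^bsub>A\<^esub> component b s"
      using A.zero_arr_unique[OF h(2) A.Comp_in[OF ts h(1)] A.zero_arrI[OF Z bs y] A.Comp_in[OF bs y]] .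
    then show "\<exists>u\<in>Hom A (on_obj P s) W. u \<cdot>\<^bsub>A\<^esub> component m s = h"
      using is_pushout_factor[OF po[OF s] ts bs h(1) y] cod by metis
  qed
  then show thesis using that m by blast
qed

text \<open>Objectwise cokernels in the opposite categories, read back through
  \<open>flip\<close>.\<close>

lemma pointwise_kernel_exists:
  assumes t: "t \<in> Hom (Fun S A) F G"
  obtains K k where "k \<in> Hom (Fun S A) K F"
    and "\<And>s. s \<in> Obj S \<Longrightarrow> is_kernel A (component t s) (component k s)"
proof -
  obtain K c where "c \<in> Hom (Fun (opposite S) (opposite A)) F K"
    "\<And>s. s \<in> Obj S \<Longrightarrow> is_kernel A (component t s) (component c s)"
    using abelian_diagrams.pointwise_cokernel_exists[OF opposite_diagrams flip_in[OF t]] by simp metis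
  then show thesis using that[OF flip_in'] by simp
qed

text \<open>Let \<open>k\<close> be the objectwise kernel of \<open>t\<close>. Monicity in
  \<open>Fun S A\<close> cancels \<open>t\<close> from \<open>tk = tz\<close>, with \<open>z\<close>
  the zero transformation, so \<open>k\<close> is zero; each component of \<open>t\<close> then has
  a zero kernel and is monic in \<open>A\<close>.\<close>

lemma monic_components:
  assumes t: "t \<in> Hom (Fun S A) F G" "monic (Fun S A) t" and s: "s \<in> Obj S"
  shows "monic A (component t s)"
proof -
  obtain K k where k: "k \<in> Hom (Fun S A) K F"
    and ker: "\<And>s. s \<in> Obj S \<Longrightarrow> is_kernel A (component t s) (component k s)"
    using pointwise_kernel_exists[OF t(1)] by metis
  obtain Z where Z: "zero_obj A Z" using A.zero_obj_exists by blast
  obtain z where z: "z \<in> Hom (Fun S A) K F" "zero_arr (Fun S A) z"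
    using Fun.zero_arr_exists[OF zero_obj_const_diag[OF Z]] Hom_FunD(1,2)[OF k] by auto
  have "zero_arr (Fun S A) (t \<cdot>\<^bsub>Fun S A\<^esub> k)"
    using is_kernelD(2)[OF pointwise_kernel[OF t(1) k ker] t(1)] .
  then have "t \<cdot>\<^bsub>Fun S A\<^esub> k = t \<cdot>\<^bsub>Fun S A\<^esub> z"
    using Fun.zero_arr_unique Fun.Comp_in[OF k t(1)] Fun.zero_comp[OF z(2,1) t(1)]
      Fun.Comp_in[OF z(1) t(1)] by blast
  then have "k = z" using monicD[OF t(2,1) k z(1)] by blast
  then have "zero_arr A (component k s)" using z zero_arr_Fun_iff s by blast
  then show ?thesis using A.kernel_zero_imp_monic[OF Hom_FunD(3)[OF t(1) s] ker[OF s]] by blast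
qed

lemma epic_components:
  assumes t: "t \<in> Hom (Fun S A) F G" "epic (Fun S A) t" and s: "s \<in> Obj S"
  shows "epic A (component t s)"
proof -
  interpret op: abelian_diagrams "opposite S" "opposite A" by (rule opposite_diagrams)
  have "monic (Fun (opposite S) (opposite A)) (flip t)"
  proof (rule monicI[OF flip_in[OF t(1)]])
    fix W g h assume gh: "g \<in> Hom (Fun (opposite S) (opposite A)) W G"
      "h \<in> Hom (Fun (opposite S) (opposite A)) W G"
      "flip t \<cdot>\<^bsub>Fun (opposite S) (opposite A)\<^esub> g = flip t \<cdot>\<^bsub>Fun (opposite S) (opposite A)\<^esub> h"
    have "flip g \<cdot>\<^bsub>Fun S A\<^esub> t = flip h \<cdot>\<^bsub>Fun S A\<^esub> t"
    proof (rule Hom_Fun_eqI[OF Fun.Comp_in[OF t(1) flip_in'[OF gh(1)]]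
          Fun.Comp_in[OF t(1) flip_in'[OF gh(2)]]])
      fix s assume s: "s \<in> Obj S"
      have "component (flip t \<cdot>\<^bsub>Fun (opposite S) (opposite A)\<^esub> g) s =
          component (flip t \<cdot>\<^bsub>Fun (opposite S) (opposite A)\<^esub> h) s" using gh(3) by simp
      then show "component (flip g \<cdot>\<^bsub>Fun S A\<^esub> t) s = component (flip h \<cdot>\<^bsub>Fun S A\<^esub> t) s"
        using s by simp
    qed
    then have "flip g = flip h" using epicD[OF t(2,1) flip_in'[OF gh(1)] flip_in'[OF gh(2)]] by blast
    then show "g = h" by (metis flip_flip)
  qed
  then show ?thesis using op.monic_components[OF flip_in[OF t(1)]] s by simp
qed

text \<open>Supplies what \<open>short_exact_is_cokernel\<close> requires of the second map: as its
  components are epic, they are cokernels of their own kernels.\<close>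

lemma epic_is_cokernel_Fun:
  assumes t: "t \<in> Hom (Fun S A) F G" "epic (Fun S A) t"
  shows "\<exists>k. is_cokernel (Fun S A) k t"
proof -
  obtain K k where k: "k \<in> Hom (Fun S A) K F"
    and ker: "\<And>s. s \<in> Obj S \<Longrightarrow> is_kernel A (component t s) (component k s)"
    using pointwise_kernel_exists[OF t(1)] by metis
  have "is_cokernel (Fun S A) k t"
    using A.epic_is_cokernel[OF epic_components[OF t] ker] by (intro pointwise_cokernel[OF k t(1)])
  then show ?thesis by blast
qed

text \<open>Completes an objectwise monomorphism by its objectwise cokernel; this produces the
  sequence to which condition (b) is applied.\<close>

lemma monic_short_exact:
  assumes t: "t \<in> Hom (Fun S A) F G" and m: "\<And>s. s \<in> Obj S \<Longrightarrow> monic A (component t s)"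
  obtains K c where "c \<in> Hom (Fun S A) G K" "short_exact (Fun S A) t c"
proof -
  obtain K c where c: "c \<in> Hom (Fun S A) G K"
    and cok: "\<And>s. s \<in> Obj S \<Longrightarrow> is_cokernel A (component t s) (component c s)"
    using pointwise_cokernel_exists[OF t] by metis
  have "is_cokernel (Fun S A) t c" using pointwise_cokernel[OF t c cok] .
  moreover have "is_kernel (Fun S A) c t"
    using A.monic_is_kernel[OF m cok] by (intro pointwise_kernel[OF c t])
  ultimately have "short_exact (Fun S A) t c"
    unfolding short_exact_def exact_at_def is_image_def
    using pointwise_monic[OF t m] Fun.is_cokernel_epic by blast
  then show thesis using that c by blast
qed

lemma monic_pushout_Fun:
  assumes t: "t \<in> Hom (Fun S A) F G" "monic (Fun S A) t" and b: "b \<in> Hom (Fun S A) F K"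
  obtains P m f where "m \<in> Hom (Fun S A) G P" "f \<in> Hom (Fun S A) K P"
    and "m \<cdot>\<^bsub>Fun S A\<^esub> t = f \<cdot>\<^bsub>Fun S A\<^esub> b"
    and "\<And>s. s \<in> Obj S \<Longrightarrow> monic A (component f s)"
proof -
  obtain P m f where m: "m \<in> Hom (Fun S A) G P" and f: "f \<in> Hom (Fun S A) K P"
    and po: "\<And>s. s \<in> Obj S \<Longrightarrow>
      is_pushout A (component t s) (component b s) (component m s) (component f s)"
    using pointwise_pushout_exists[OF t(1) b] by metis
  have "m \<cdot>\<^bsub>Fun S A\<^esub> t = f \<cdot>\<^bsub>Fun S A\<^esub> b"
    using is_pushoutD(3)[OF po Hom_FunD(3)[OF t(1)] Hom_FunD(3)[OF b]]
    by (intro Hom_Fun_eqI[OF Fun.Comp_in[OF t(1) m] Fun.Comp_in[OF b f]]) simp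
  moreover have "monic A (component f s)" if "s \<in> Obj S" for s
    using A.pushout_monic[OF po Hom_FunD(3)[OF t(1)] Hom_FunD(3)[OF b] monic_components[OF t]] that
    by blast
  ultimately show thesis using that m f by blast
qed

end

subsection \<open>Colimits\<close>

locale cocomplete_abelian = abelian_diagrams S A
  for S :: "('o, 'm) cat" and A :: "('p, 'q) cat" +
  assumes cocomplete: "cocomplete S A"
begin

abbreviation "K \<equiv> on_obj (const_diag S A)"
abbreviation "\<kappa> \<equiv> on_arr (const_diag S A)"
abbreviation "L \<equiv> colim_obj S A"
abbreviation "\<rho> \<equiv> univ_trans S A"

lemma is_colimit_colim:
  assumes "F \<in> functors S A"
  shows "is_colimit S A F (L F) (\<rho> F)"
proof -
  have "\<exists>p. case p of (C, \<sigma>) \<Rightarrow> is_colimit S A F C \<sigma>"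
    using cocomplete assms unfolding cocomplete_def by auto
  then have "case colimit S A F of (C, \<sigma>) \<Rightarrow> is_colimit S A F C \<sigma>"
    unfolding colimit_def by (rule someI_ex)
  then show ?thesis by (simp add: colim_obj_def univ_trans_def split: prod.splits)
qed

lemma colim_obj_in: "F \<in> functors S A \<Longrightarrow> L F \<in> Obj A"
  and univ_trans_in: "F \<in> functors S A \<Longrightarrow> \<rho> F \<in> Hom (Fun S A) F (K (L F))"
  using is_colimit_colim unfolding is_colimit_def by blast+

lemma colim_ex1:
  assumes "\<sigma> \<in> Hom (Fun S A) F (K X)" "X \<in> Obj A"
  shows "\<exists>!u. u \<in> Hom A (L F) X \<and> \<kappa> u \<cdot>\<^bsub>Fun S A\<^esub> \<rho> F = \<sigma>"
  using is_colimit_colim[OF Hom_FunD(1)[OF assms(1)]] assms unfolding is_colimit_def by blast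

lemma colim_eqI:
  assumes "F \<in> functors S A" "u \<in> Hom A (L F) X" "v \<in> Hom A (L F) X"
    and "\<kappa> u \<cdot>\<^bsub>Fun S A\<^esub> \<rho> F = \<kappa> v \<cdot>\<^bsub>Fun S A\<^esub> \<rho> F"
  shows "u = v"
  using colim_ex1[OF Fun.Comp_in[OF univ_trans_in[OF assms(1)] const_diag_arr_in[OF assms(3)]]
      A.Hom_Obj(2)[OF assms(3)]] assms by blast

lemma colim_arr:
  assumes t: "t \<in> Hom (Fun S A) F G"
  shows "colim_arr S A t \<in> Hom A (L F) (L G)"
    and "\<kappa> (colim_arr S A t) \<cdot>\<^bsub>Fun S A\<^esub> \<rho> F = \<rho> G \<cdot>\<^bsub>Fun S A\<^esub> t"
proof -
  note G = Hom_FunD(2)[OF t]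
  have "\<exists>!u. u \<in> Hom A (L F) (L G) \<and> \<kappa> u \<cdot>\<^bsub>Fun S A\<^esub> \<rho> F = \<rho> G \<cdot>\<^bsub>Fun S A\<^esub> t"
    using colim_ex1[OF Fun.Comp_in[OF t univ_trans_in[OF G]] colim_obj_in[OF G]] .
  from theI'[OF this] show "colim_arr S A t \<in> Hom A (L F) (L G)"
    "\<kappa> (colim_arr S A t) \<cdot>\<^bsub>Fun S A\<^esub> \<rho> F = \<rho> G \<cdot>\<^bsub>Fun S A\<^esub> t"
    using t unfolding colim_arr_def Hom_Fun_iff by auto
qed

lemma codiagonal:
  assumes X: "X \<in> Obj A"
  shows "codiagonal S A X \<in> Hom A (L (K X)) X"
    and "\<kappa> (codiagonal S A X) \<cdot>\<^bsub>Fun S A\<^esub> \<rho> (K X) = Id (Fun S A) (K X)"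
proof -
  have "Id (Fun S A) (K X) \<in> Hom (Fun S A) (K X) (K X)"
    using Fun.Id_in const_diag_obj_in[OF X] by simp
  from theI'[OF colim_ex1[OF this X]] show "codiagonal S A X \<in> Hom A (L (K X)) X"
    "\<kappa> (codiagonal S A X) \<cdot>\<^bsub>Fun S A\<^esub> \<rho> (K X) = Id (Fun S A) (K X)"
    unfolding codiagonal_def Let_def by blast+
qed

text \<open>The adjunction sends \<open>h\<close> to \<open>\<kappa> h\<close> after
  \<open>\<rho> G\<close>, and this is its naturality in the diagram. It translates equations
  between arrows out of a colimit into equations between transformations.\<close>

lemma const_comp_univ_trans:
  assumes t: "t \<in> Hom (Fun S A) F G" and h: "h \<in> Hom A (L G) X"
  shows "\<kappa> (h \<cdot>\<^bsub>A\<^esub> colim_arr S A t) \<cdot>\<^bsub>Fun S A\<^esub> \<rho> F = (\<kappa> h \<cdot>\<^bsub>Fun S A\<^esub> \<rho> G) \<cdot>\<^bsub>Fun S A\<^esub> t"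
proof -
  note l = colim_arr[OF t] and F = Hom_FunD(1)[OF t] and G = Hom_FunD(2)[OF t]
  have "\<kappa> (h \<cdot>\<^bsub>A\<^esub> colim_arr S A t) \<cdot>\<^bsub>Fun S A\<^esub> \<rho> F =
      \<kappa> h \<cdot>\<^bsub>Fun S A\<^esub> (\<kappa> (colim_arr S A t) \<cdot>\<^bsub>Fun S A\<^esub> \<rho> F)"
    using const_diag_comp[OF l(1) h]
      Fun.Comp_assoc[OF univ_trans_in[OF F] const_diag_arr_in[OF l(1)] const_diag_arr_in[OF h]] by simp
  also have "\<dots> = (\<kappa> h \<cdot>\<^bsub>Fun S A\<^esub> \<rho> G) \<cdot>\<^bsub>Fun S A\<^esub> t"
    using l(2) Fun.Comp_assoc[OF t univ_trans_in[OF G] const_diag_arr_in[OF h]] by simp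
  finally show ?thesis .
qed

lemma colim_arr_comp:
  assumes t: "t \<in> Hom (Fun S A) F G" and r: "r \<in> Hom (Fun S A) G M"
  shows "colim_arr S A (r \<cdot>\<^bsub>Fun S A\<^esub> t) = colim_arr S A r \<cdot>\<^bsub>A\<^esub> colim_arr S A t"
proof -
  note rt = Fun.Comp_in[OF t r]
  show ?thesis
    using colim_arr(2)[OF rt] const_comp_univ_trans[OF t colim_arr(1)[OF r]] colim_arr(2)[OF r]
      Fun.Comp_assoc[OF t r univ_trans_in[OF Hom_FunD(2)[OF r]]]
    by (intro colim_eqI[OF Hom_FunD(1)[OF t] colim_arr(1)[OF rt]
          A.Comp_in[OF colim_arr(1)[OF t] colim_arr(1)[OF r]]]) simp
qed

lemma colim_arr_Id:
  assumes F: "F \<in> functors S A"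
  shows "colim_arr S A (Id (Fun S A) F) = Id A (L F)"
proof -
  have i: "Id (Fun S A) F \<in> Hom (Fun S A) F F" using Fun.Id_in F by simp
  show ?thesis
    using colim_arr(2)[OF i] const_diag_Id[OF colim_obj_in[OF F]] Fun.Id_Comp[OF univ_trans_in[OF F]]
      Fun.Comp_Id[OF univ_trans_in[OF F]]
    by (intro colim_eqI[OF F colim_arr(1)[OF i] A.Id_in[OF colim_obj_in[OF F]]]) simp
qed

lemma is_functor_colim: "is_functor (Fun S A) A (colim S A)"
  unfolding is_functor_def
proof (intro conjI ballI impI)
  fix t assume t: "t \<in> Arr (Fun S A)"
  note t' = Arr_Hom[OF t]
  show "on_arr (colim S A) t \<in>
      Hom A (on_obj (colim S A) (Dom (Fun S A) t)) (on_obj (colim S A) (Cod (Fun S A) t))"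
    using colim_arr(1)[OF t'] by (simp add: colim_def)
  fix r assume r: "r \<in> Arr (Fun S A)" "Cod (Fun S A) t = Dom (Fun S A) r"
  show "on_arr (colim S A) (r \<cdot>\<^bsub>Fun S A\<^esub> t) = on_arr (colim S A) r \<cdot>\<^bsub>A\<^esub> on_arr (colim S A) t"
    using colim_arr_comp[OF t'] Arr_Hom[OF r(1)] r(2) by (simp add: colim_def)
qed (simp_all add: colim_def colim_obj_in colim_arr_Id)

section \<open>Right exactness of the colimit functor\<close>

lemma colim_epic:
  assumes t: "t \<in> Hom (Fun S A) F G" "epic (Fun S A) t"
  shows "epic A (colim_arr S A t)"
proof (rule epicI[OF colim_arr(1)[OF t(1)]])
  note G = Hom_FunD(2)[OF t(1)]
  fix W g h assume gh: "g \<in> Hom A (L G) W" "h \<in> Hom A (L G) W"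
    "g \<cdot>\<^bsub>A\<^esub> colim_arr S A t = h \<cdot>\<^bsub>A\<^esub> colim_arr S A t"
  have "(\<kappa> g \<cdot>\<^bsub>Fun S A\<^esub> \<rho> G) \<cdot>\<^bsub>Fun S A\<^esub> t = (\<kappa> h \<cdot>\<^bsub>Fun S A\<^esub> \<rho> G) \<cdot>\<^bsub>Fun S A\<^esub> t"
    using const_comp_univ_trans[OF t(1)] gh by metis
  then have "\<kappa> g \<cdot>\<^bsub>Fun S A\<^esub> \<rho> G = \<kappa> h \<cdot>\<^bsub>Fun S A\<^esub> \<rho> G"
    using epicD[OF t(2,1)] Fun.Comp_in[OF univ_trans_in[OF G] const_diag_arr_in] gh(1,2) by blast
  then show "g = h" using colim_eqI[OF G gh(1,2)] by blast
qed

lemma zero_arr_const_diag: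
  "h \<in> Hom A X Y \<Longrightarrow> zero_arr A h \<Longrightarrow> zero_arr (Fun S A) (\<kappa> h)"
  using zero_arr_Fun_iff[OF const_diag_arr_in] by simp

text \<open>The zero arrow between the colimits satisfies the equation that characterises
  \<open>colim_arr S A t\<close>.\<close>

lemma zero_arr_colim:
  assumes t: "t \<in> Hom (Fun S A) F G" "zero_arr (Fun S A) t"
  shows "zero_arr A (colim_arr S A t)"
proof -
  note F = Hom_FunD(1)[OF t(1)] and G = Hom_FunD(2)[OF t(1)]
  obtain Z where Z: "zero_obj A Z" using A.zero_obj_exists by blast
  obtain z where z: "z \<in> Hom A (L F) (L G)" "zero_arr A z"
    by (rule A.zero_arr_exists[OF Z colim_obj_in[OF F] colim_obj_in[OF G]])
  note zF = const_diag_arr_in[OF z(1)]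
  have "\<kappa> z \<cdot>\<^bsub>Fun S A\<^esub> \<rho> F = \<rho> G \<cdot>\<^bsub>Fun S A\<^esub> t"
    using Fun.zero_arr_unique[OF Fun.comp_zero[OF zero_arr_const_diag[OF z] univ_trans_in[OF F] zF]
        Fun.Comp_in[OF univ_trans_in[OF F] zF] Fun.zero_comp[OF t(2,1) univ_trans_in[OF G]]
        Fun.Comp_in[OF t(1) univ_trans_in[OF G]]] .
  then have "z = colim_arr S A t"
    using colim_eqI[OF F z(1) colim_arr(1)[OF t(1)]] colim_arr(2)[OF t(1)] by simp
  then show ?thesis using z(2) by simp
qed

text \<open>An arrow \<open>h\<close> that kills \<open>colim(t)\<close> transposes to a
  transformation that kills \<open>t\<close>. The latter factors through \<open>c\<close>, and
  transposing the factor back gives the factorization of \<open>h\<close>.\<close>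

lemma colim_cokernel:
  assumes t: "t \<in> Hom (Fun S A) F G" and c: "c \<in> Hom (Fun S A) G M" "is_cokernel (Fun S A) t c"
  shows "is_cokernel A (colim_arr S A t) (colim_arr S A c)"
proof (rule is_cokernelI[OF colim_arr(1)[OF t] colim_arr(1)[OF c(1)]])
  note F = Hom_FunD(1)[OF t] and G = Hom_FunD(2)[OF t] and M = Hom_FunD(2)[OF c(1)]
  show "zero_arr A (colim_arr S A c \<cdot>\<^bsub>A\<^esub> colim_arr S A t)"
    using zero_arr_colim[OF Fun.Comp_in[OF t c(1)] is_cokernelD(2)[OF c(2) t]]
      colim_arr_comp[OF t c(1)] by simp
  show "epic A (colim_arr S A c)" using colim_epic[OF c(1) Fun.is_cokernel_epic[OF c(2)]] .
  fix W h assume h: "h \<in> Hom A (L G) W" "zero_arr A (h \<cdot>\<^bsub>A\<^esub> colim_arr S A t)"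
  note W = A.Hom_Obj(2)[OF h(1)]
  have hG: "\<kappa> h \<cdot>\<^bsub>Fun S A\<^esub> \<rho> G \<in> Hom (Fun S A) G (K W)"
    using Fun.Comp_in[OF univ_trans_in[OF G] const_diag_arr_in[OF h(1)]] .
  have ht: "h \<cdot>\<^bsub>A\<^esub> colim_arr S A t \<in> Hom A (L F) W" using A.Comp_in[OF colim_arr(1)[OF t] h(1)] .
  have "zero_arr (Fun S A) ((\<kappa> h \<cdot>\<^bsub>Fun S A\<^esub> \<rho> G) \<cdot>\<^bsub>Fun S A\<^esub> t)"
    using Fun.comp_zero[OF zero_arr_const_diag[OF ht h(2)] univ_trans_in[OF F] const_diag_arr_in[OF ht]]
      const_comp_univ_trans[OF t h(1)] by simp
  then obtain v where v: "v \<in> Hom (Fun S A) M (K W)" "v \<cdot>\<^bsub>Fun S A\<^esub> c = \<kappa> h \<cdot>\<^bsub>Fun S A\<^esub> \<rho> G"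
    using is_cokernel_factor[OF c(2) t hG] Hom_D(3)[OF c(1)] by metis
  obtain u where u: "u \<in> Hom A (L M) W" "\<kappa> u \<cdot>\<^bsub>Fun S A\<^esub> \<rho> M = v" using colim_ex1[OF v(1) W] by blast
  have "u \<cdot>\<^bsub>A\<^esub> colim_arr S A c = h"
    using const_comp_univ_trans[OF c(1) u(1)] u(2) v(2)
    by (intro colim_eqI[OF G A.Comp_in[OF colim_arr(1)[OF c(1)] u(1)] h(1)]) simp
  then show "\<exists>u\<in>Hom A (L M) W. u \<cdot>\<^bsub>A\<^esub> colim_arr S A c = h" using u(1) by blast
qed

lemma short_exact_Hom:
  assumes "short_exact (Fun S A) \<phi> \<psi>"
  obtains F G M where "\<phi> \<in> Hom (Fun S A) F G" "\<psi> \<in> Hom (Fun S A) G M"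
proof -
  obtain c m where "is_cokernel (Fun S A) \<phi> c" "is_kernel (Fun S A) c m" "is_kernel (Fun S A) \<psi> m"
    using assms unfolding short_exact_def exact_at_def is_image_def by blast
  then have "\<phi> \<in> Arr (Fun S A)" "\<psi> \<in> Arr (Fun S A)" "Dom (Fun S A) \<psi> = Cod (Fun S A) \<phi>"
    by (auto simp: is_kernel_def is_cokernel_def)
  then show thesis using that Arr_Hom by metis
qed

lemma colim_short_exact:
  assumes se: "short_exact (Fun S A) \<phi> \<psi>" and m: "monic A (colim_arr S A \<phi>)"
  shows "short_exact A (colim_arr S A \<phi>) (colim_arr S A \<psi>)"
proof -
  obtain F G M where \<phi>: "\<phi> \<in> Hom (Fun S A) F G" and \<psi>: "\<psi> \<in> Hom (Fun S A) G M"
    by (rule short_exact_Hom[OF se])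
  have epi: "epic (Fun S A) \<psi>" using se by (simp add: short_exact_def)
  then have "is_cokernel (Fun S A) \<phi> \<psi>"
    using Fun.short_exact_is_cokernel[OF se] epic_is_cokernel_Fun[OF \<psi>] by blast
  then have "is_cokernel A (colim_arr S A \<phi>) (colim_arr S A \<psi>)" by (rule colim_cokernel[OF \<phi> \<psi>])
  \<comment> \<open>The kernel \<open>k\<close> is at once the image of
    \<open>colim(\<phi>)\<close>, because \<open>colim(\<psi>)\<close> is a cokernel of that arrow;
    this is exactness in the middle.\<close>
  moreover obtain k where "is_kernel A (colim_arr S A \<psi>) k"
    by (rule A.kernel_exists[OF colim_arr(1)[OF \<psi>]])
  ultimately show ?thesis
    unfolding short_exact_def exact_at_def is_image_def using m colim_epic[OF \<psi> epi] by blast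
qed

section \<open>The arrow \<open>f_eta\<close> and preservation of monomorphisms\<close>

lemma eta_pushout:
  assumes X: "X \<in> Obj A" and \<phi>: "\<phi> \<in> Hom (Fun S A) (K X) F"
  obtains \<mu> where "is_pushout A (colim_arr S A \<phi>) (codiagonal S A X) \<mu> (f_eta S A X \<phi>)"
proof -
  let ?P = "\<lambda>\<mu> f. is_pushout A (on_arr (colim S A) \<phi>) (codiagonal S A X) \<mu> f"
  have "\<exists>p. case p of (\<mu>, f) \<Rightarrow> ?P \<mu> f"
    using A.pushout_exists[OF colim_arr(1)[OF \<phi>] codiagonal(1)[OF X]] by (simp add: colim_def) metis
  then have "case eta_pushout S A X \<phi> of (\<mu>, f) \<Rightarrow> ?P \<mu> f"
    unfolding eta_pushout_def by (rule someI_ex)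
  then show thesis using that by (simp add: f_eta_def colim_def split: prod.splits)
qed

lemma f_eta_monic:
  assumes "X \<in> Obj A" "\<phi> \<in> Hom (Fun S A) (K X) F" "monic A (colim_arr S A \<phi>)"
  shows "monic A (f_eta S A X \<phi>)"
  using eta_pushout[OF assms(1,2)]
    A.pushout_monic[OF _ colim_arr(1)[OF assms(2)] codiagonal(1)[OF assms(1)] assms(3)] by metis

text \<open>Composed with \<open>\<rho> F\<close>, the left side becomes \<open>\<kappa>\<close> of
  the codiagonal after \<open>\<rho> (K (L F))\<close> after \<open>\<rho> F\<close>. The first two
  cancel by the definition of the codiagonal.\<close>

lemma codiagonal_colim_univ_trans:
  assumes F: "F \<in> functors S A"
  shows "codiagonal S A (L F) \<cdot>\<^bsub>A\<^esub> colim_arr S A (\<rho> F) = Id A (L F)"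
proof -
  note X = colim_obj_in[OF F] and r = univ_trans_in[OF F]
  note d = codiagonal[OF X]
  show ?thesis
    using const_comp_univ_trans[OF r d(1)] d(2) Fun.Id_Comp[OF r] const_diag_Id[OF X]
    by (intro colim_eqI[OF F A.Comp_in[OF colim_arr(1)[OF r] d(1)] A.Id_in[OF X]]) simp
qed

text \<open>The assumption \<open>f\<close> is condition (b) in rule form; it is applied at the
  object \<open>L F\<close> and the pushed-out map \<open>\<phi>'\<close>.\<close>

lemma colim_monic:
  assumes f: "\<And>X F G \<phi> \<psi>. X \<in> Obj A \<Longrightarrow> \<phi> \<in> Hom (Fun S A) (K X) F \<Longrightarrow> \<psi> \<in> Hom (Fun S A) F G \<Longrightarrow>
      short_exact (Fun S A) \<phi> \<psi> \<Longrightarrow> monic A (f_eta S A X \<phi>)"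
    and \<phi>: "\<phi> \<in> Hom (Fun S A) F G" "monic (Fun S A) \<phi>"
  shows "monic A (colim_arr S A \<phi>)"
proof -
  note F = Hom_FunD(1)[OF \<phi>(1)]
  note X = colim_obj_in[OF F] and r = univ_trans_in[OF F]
  obtain P \<nu> \<phi>' where \<nu>: "\<nu> \<in> Hom (Fun S A) G P" and \<phi>': "\<phi>' \<in> Hom (Fun S A) (K (L F)) P"
    and sq: "\<nu> \<cdot>\<^bsub>Fun S A\<^esub> \<phi> = \<phi>' \<cdot>\<^bsub>Fun S A\<^esub> \<rho> F"
    and mon: "\<And>s. s \<in> Obj S \<Longrightarrow> monic A (component \<phi>' s)"
    using monic_pushout_Fun[OF \<phi> r] by metis
  obtain M \<psi> where "\<psi> \<in> Hom (Fun S A) P M" "short_exact (Fun S A) \<phi>' \<psi>"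
    by (rule monic_short_exact[OF \<phi>' mon])
  then have fm: "monic A (f_eta S A (L F) \<phi>')" by (rule f[OF X \<phi>'])
  let ?f = "f_eta S A (L F) \<phi>'" and ?d = "codiagonal S A (L F)" and ?L = "colim_arr S A"
  obtain \<mu> where po: "is_pushout A (?L \<phi>') ?d \<mu> ?f"
    by (rule eta_pushout[OF X \<phi>'])
  note L\<phi>' = colim_arr(1)[OF \<phi>'] and L\<nu> = colim_arr(1)[OF \<nu>] and Lr = colim_arr(1)[OF r]
    and L\<phi> = colim_arr(1)[OF \<phi>(1)] and d = codiagonal(1)[OF X]
  note \<mu> = is_pushoutD[OF po L\<phi>' d]
  \<comment> \<open>The inserted identity creates the composite of \<open>?f\<close> with the
    codiagonal, which the pushout square replaces by \<open>\<mu>\<close> after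
    \<open>colim(\<phi>')\<close>. Functoriality applied to \<open>sq\<close> then brings in
    \<open>colim(\<phi>)\<close> as the first factor.\<close>
  have "?f = ?f \<cdot>\<^bsub>A\<^esub> (?d \<cdot>\<^bsub>A\<^esub> ?L (\<rho> F))"
    using codiagonal_colim_univ_trans[OF F] A.Comp_Id[OF \<mu>(2)] by simp
  also have "\<dots> = \<mu> \<cdot>\<^bsub>A\<^esub> (?L \<phi>' \<cdot>\<^bsub>A\<^esub> ?L (\<rho> F))"
    using A.Comp_assoc[OF Lr d \<mu>(2)] A.Comp_assoc[OF Lr L\<phi>' \<mu>(1)] \<mu>(3) by simp
  also have "\<dots> = \<mu> \<cdot>\<^bsub>A\<^esub> (?L \<nu> \<cdot>\<^bsub>A\<^esub> ?L \<phi>)"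
    using colim_arr_comp[OF r \<phi>'] colim_arr_comp[OF \<phi>(1) \<nu>] sq by simp
  also have "\<dots> = (\<mu> \<cdot>\<^bsub>A\<^esub> ?L \<nu>) \<cdot>\<^bsub>A\<^esub> ?L \<phi>" using A.Comp_assoc[OF L\<phi> L\<nu> \<mu>(1)] .
  finally have f_eq: "?f = (\<mu> \<cdot>\<^bsub>A\<^esub> ?L \<nu>) \<cdot>\<^bsub>A\<^esub> ?L \<phi>" .
  show ?thesis
  proof (rule monicI[OF L\<phi>])
    fix W g h assume gh: "g \<in> Hom A W (L F)" "h \<in> Hom A W (L F)" "?L \<phi> \<cdot>\<^bsub>A\<^esub> g = ?L \<phi> \<cdot>\<^bsub>A\<^esub> h"
    have "?f \<cdot>\<^bsub>A\<^esub> g = ?f \<cdot>\<^bsub>A\<^esub> h"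
      using A.Comp_assoc[OF _ L\<phi> A.Comp_in[OF L\<nu> \<mu>(1)]] gh f_eq by metis
    then show "g = h" using monicD[OF fm \<mu>(2) gh(1,2)] by blast
  qed
qed

end

theorem theorem2:
  fixes S :: "('o, 'm) cat" and A :: "('p, 'q) cat"
  assumes "category S"
    and "abelian_category A"
    and "cocomplete S A"
  shows "exact_functor (Fun S A) A (colim S A) \<longleftrightarrow>
    (\<forall>X \<in> Obj A. \<forall>F \<in> Obj (Fun S A). \<forall>G \<in> Obj (Fun S A).
       \<forall>\<phi> \<in> Hom (Fun S A) (on_obj (const_diag S A) X) F. \<forall>\<psi> \<in> Hom (Fun S A) F G.
         short_exact (Fun S A) \<phi> \<psi> \<longrightarrow> monic A (f_eta S A X \<phi>))"
proof -
  interpret category S by fact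
  interpret abelian A using assms(2) by (simp add: abelian_iff)
  interpret cocomplete_abelian S A by unfold_locales (rule assms(3))
  show ?thesis
  proof
    assume ex: "exact_functor (Fun S A) A (colim S A)"
    show "\<forall>X \<in> Obj A. \<forall>F \<in> Obj (Fun S A). \<forall>G \<in> Obj (Fun S A).
       \<forall>\<phi> \<in> Hom (Fun S A) (on_obj (const_diag S A) X) F. \<forall>\<psi> \<in> Hom (Fun S A) F G.
         short_exact (Fun S A) \<phi> \<psi> \<longrightarrow> monic A (f_eta S A X \<phi>)"
    proof (intro ballI impI)
      fix X F G \<phi> \<psi> assume X: "X \<in> Obj A" and \<phi>: "\<phi> \<in> Hom (Fun S A) (K X) F"
        and "short_exact (Fun S A) \<phi> \<psi>"
      then have "short_exact A (colim_arr S A \<phi>) (colim_arr S A \<psi>)"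
        using ex by (simp add: exact_functor_def colim_def)
      then show "monic A (f_eta S A X \<phi>)" using f_eta_monic[OF X \<phi>] by (simp add: short_exact_def)
    qed
  next
    assume "\<forall>X \<in> Obj A. \<forall>F \<in> Obj (Fun S A). \<forall>G \<in> Obj (Fun S A).
       \<forall>\<phi> \<in> Hom (Fun S A) (on_obj (const_diag S A) X) F. \<forall>\<psi> \<in> Hom (Fun S A) F G.
         short_exact (Fun S A) \<phi> \<psi> \<longrightarrow> monic A (f_eta S A X \<phi>)"
    then have f: "monic A (f_eta S A X \<phi>)"
      if "X \<in> Obj A" "\<phi> \<in> Hom (Fun S A) (K X) F" "\<psi> \<in> Hom (Fun S A) F G"
        "short_exact (Fun S A) \<phi> \<psi>" for X F G \<phi> \<psi>
      using that Hom_FunD(2)[OF that(2)] Hom_FunD(2)[OF that(3)] Obj_Fun by metis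
    \<comment> \<open>Condition (b) enters only through monicity of the image of
      \<open>\<phi>\<close>; \<open>colim_short_exact\<close> supplies the rest from right
      exactness.\<close>
    have "short_exact A (colim_arr S A \<phi>) (colim_arr S A \<psi>)" if se: "short_exact (Fun S A) \<phi> \<psi>" for \<phi> \<psi>
    proof -
      obtain F G M where "\<phi> \<in> Hom (Fun S A) F G" "\<psi> \<in> Hom (Fun S A) G M"
        by (rule short_exact_Hom[OF se])
      then show ?thesis
        using colim_short_exact[OF se] colim_monic[OF f] se by (simp add: short_exact_def)
    qed
    then show "exact_functor (Fun S A) A (colim S A)"
      using is_functor_colim by (simp add: exact_functor_def colim_def)
  qed
qed

end
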